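(* Let $(\mathcal{X},d_\mathcal{X})$, $(\mathcal{Y}_k,d_{\mathcal{Y}_k})$, $k=1,\dots,K$, be compact metric spaces, $c_k:\mathcal{X}\times\mathcal{Y}_k\to\mathbb{R}_+$ continuous, and assume that for every $Y=(y_1,\dots,y_K)\in\mathcal{Y}:=\mathcal{Y}_1\times\cdots\times\mathcal{Y}_K$ the function $x\mapsto\sum_k c_k(x,y_k)$ has a unique minimiser $B(Y)$ on $\mathcal{X}$, and that there exist $x\in\mathcal{X}$, $Y\in\mathcal{Y}$ with $x\ne B(Y)$. Fix $\nu_k\in\mathcal{P}(\mathcal{Y}_k)$. For any $\mu_0\in\mathcal{P}(\mathcal{X})$, let $(\mu_t)_{t\in\mathbb{N}}$ be any sequence with $\mu_{t+1}\in G(\mu_t)$ for all $t$. Then $(\mu_t)$ has weakly converging subsequences, and any weakly converging subsequence converges to some $\mu\in\mathcal{P}(\mathcal{X})$ satisfying $\mu\in G(\mu)$.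
   Context: $\mathcal{P}(S)$ denotes Borel probability measures with the weak topology. For $\mu\in\mathcal{P}(\mathcal{X})$, $\Pi^*_{c_k}(\mu,\nu_k)$ is the set of optimal couplings for $\inf_{\pi\in\Pi(\mu,\nu_k)}\int c_k\,\mathrm{d}\pi$. $\Gamma(\mu)$ is the set of $\gamma\in\mathcal{P}(\mathcal{X}\times\mathcal{Y}_1\times\cdots\times\mathcal{Y}_K)$ whose marginal $\gamma_{0,k}$ on $\mathcal{X}\times\mathcal{Y}_k$ lies in $\Pi^*_{c_k}(\mu,\nu_k)$ for each $k$, and $G(\mu):=\{B\#\gamma_{1,\dots,K}:\gamma\in\Gamma(\mu)\}$, where $\gamma_{1,\dots,K}$ is the marginal of $\gamma$ on $\mathcal{Y}$ and $\#$ denotes push-forward. *)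

theory Defs
  imports "HOL-Probability.Probability"
begin

text \<open>Borel probability measures on a compact set S of a metric space type,
  represented as probability measures on the Borel sets of the ambient type
  giving full mass to S.\<close>
definition Prob_on :: "'a::metric_space set \<Rightarrow> 'a measure \<Rightarrow> bool" where
  "Prob_on S M \<longleftrightarrow> prob_space M \<and> sets M = sets borel \<and> emeasure M S = 1"

definition weak_conv_on :: "'a::metric_space set \<Rightarrow> (nat \<Rightarrow> 'a measure) \<Rightarrow> 'a measure \<Rightarrow> bool" where
  "weak_conv_on S Ms M \<longleftrightarrow>
     (\<forall>f::'a \<Rightarrow> real. continuous_on S f \<longrightarrow>
        (\<lambda>n. \<integral>x. indicator S x * f x \<partial>Ms n) \<longlonglongrightarrow> (\<integral>x. indicator S x * f x \<partial>M))"

definition couplings :: "'a::metric_space measure \<Rightarrow> 'b::metric_space measure \<Rightarrow> ('a \<times> 'b) measure set" where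
  "couplings \<mu> \<nu> = {\<pi>. prob_space \<pi> \<and> sets \<pi> = sets (borel \<Otimes>\<^sub>M borel)
      \<and> distr \<pi> borel fst = \<mu> \<and> distr \<pi> borel snd = \<nu>}"

definition cost_of :: "'a::metric_space set \<Rightarrow> 'b::metric_space set \<Rightarrow> ('a \<Rightarrow> 'b \<Rightarrow> real) \<Rightarrow> ('a \<times> 'b) measure \<Rightarrow> real" where
  "cost_of X Yk c \<pi> = (\<integral>p. indicator (X \<times> Yk) p * c (fst p) (snd p) \<partial>\<pi>)"

definition opt_couplings :: "'a::metric_space set \<Rightarrow> 'b::metric_space set \<Rightarrow> ('a \<Rightarrow> 'b \<Rightarrow> real)
    \<Rightarrow> 'a measure \<Rightarrow> 'b measure \<Rightarrow> ('a \<times> 'b) measure set" where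
  "opt_couplings X Yk c \<mu> \<nu> = {\<pi> \<in> couplings \<mu> \<nu>.
      \<forall>\<pi>' \<in> couplings \<mu> \<nu>. cost_of X Yk c \<pi> \<le> cost_of X Yk c \<pi>'}"

text \<open>Y = Y_1 x ... x Y_K is represented by extensional functions on {..<K};
  its measurable structure is the product sigma algebra.\<close>
definition Ymeas :: "nat \<Rightarrow> (nat \<Rightarrow> 'b::metric_space) measure" where
  "Ymeas K = PiM {..<K} (\<lambda>_. borel)"

definition Gamma_set :: "nat \<Rightarrow> 'a::metric_space set \<Rightarrow> (nat \<Rightarrow> 'b::metric_space set)
    \<Rightarrow> (nat \<Rightarrow> 'a \<Rightarrow> 'b \<Rightarrow> real) \<Rightarrow> (nat \<Rightarrow> 'b measure) \<Rightarrow> 'a measure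
    \<Rightarrow> ('a \<times> (nat \<Rightarrow> 'b)) measure set" where
  "Gamma_set K X Y c \<nu> \<mu> = {\<gamma>. prob_space \<gamma> \<and> sets \<gamma> = sets (borel \<Otimes>\<^sub>M Ymeas K) \<and>
      (\<forall>k<K. distr \<gamma> (borel \<Otimes>\<^sub>M borel) (\<lambda>(x, v). (x, v k)) \<in> opt_couplings X (Y k) (c k) \<mu> (\<nu> k))}"

text \<open>The barycentre map, used on Y = PiE {..<K} Y (constant outside, which is a null set).\<close>
definition Bext :: "nat \<Rightarrow> 'a set \<Rightarrow> (nat \<Rightarrow> 'b set) \<Rightarrow> ((nat \<Rightarrow> 'b) \<Rightarrow> 'a) \<Rightarrow> (nat \<Rightarrow> 'b) \<Rightarrow> 'a" where
  "Bext K X Y B v = (if v \<in> PiE {..<K} Y then B v else (SOME x. x \<in> X))"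

definition G_set :: "nat \<Rightarrow> 'a::metric_space set \<Rightarrow> (nat \<Rightarrow> 'b::metric_space set)
    \<Rightarrow> (nat \<Rightarrow> 'a \<Rightarrow> 'b \<Rightarrow> real) \<Rightarrow> (nat \<Rightarrow> 'b measure) \<Rightarrow> ((nat \<Rightarrow> 'b) \<Rightarrow> 'a)
    \<Rightarrow> 'a measure \<Rightarrow> 'a measure set" where
  "G_set K X Y c \<nu> B \<mu> =
     {distr (distr \<gamma> (Ymeas K) snd) borel (Bext K X Y B) | \<gamma>. \<gamma> \<in> Gamma_set K X Y c \<nu> \<mu>}"

end

theory Submission
  imports Defs
begin

text \<open>The total transport cost is a Lyapunov function. If \<open>\<gamma>\<^sub>t \<in> \<Gamma>(\<mu>\<^sub>t)\<close> induces \<open>\<mu>\<^sub>t\<^sub>+\<^sub>1\<close>, then replacing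
  \<open>x\<close> by \<open>B(Y)\<close> in \<open>\<gamma>\<^sub>t\<close> gives admissible couplings of \<open>\<mu>\<^sub>t\<^sub>+\<^sub>1\<close> with the \<open>\<nu>\<^sub>k\<close>, so
  \<open>F(\<mu>\<^sub>t\<^sub>+\<^sub>1) \<le> \<integral> \<Sum>\<^sub>k c\<^sub>k(B(Y), y\<^sub>k) d\<gamma>\<^sub>t \<le> \<integral> \<Sum>\<^sub>k c\<^sub>k(x, y\<^sub>k) d\<gamma>\<^sub>t = F(\<mu>\<^sub>t)\<close>.
  Both integrals therefore have the same limit. Along a weakly convergent subsequence of \<open>\<mu>\<^sub>t\<close> extract a
  weak limit \<open>\<gamma>\<close> of the \<open>\<gamma>\<^sub>t\<close>; the two integrals agree for \<open>\<gamma>\<close>, and uniqueness of the minimiser forces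
  \<open>x = B(Y)\<close> almost surely. Since optimality of couplings is stable under weak limits, \<open>\<gamma> \<in> \<Gamma>(\<mu>)\<close>
  and \<open>\<mu>\<close> is its own image. Weak limits are handled through almost surely convergent random
  variables, obtained by coding a compact metric space into the real line.\<close>

section \<open>Coding compact metric spaces by real numbers\<close>

text \<open>Uniqueness of the minimiser acts twice. Together with compactness of X it makes B
  continuous, so the smaller integrand is continuous too and both integrals pass to weak limits;
  then strictness of the minimum turns equality of the two integrals into x = B(Y). Nonnegativity of
  the costs bounds the decreasing sequence of total costs from below. The obstacle is that the
  ambient metric spaces are arbitrary, possibly neither separable nor complete, and that couplings
  live on product sigma-algebras. Every topological argument therefore takes place on a compact set
  of full mass, where a Borel code with uniformly continuous inverse exists. Stability of optimality
  is proved without duality: a competitor for the limit marginals is moved to the approximating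
  marginals by gluing along a countable partition into small cells, at a price controlled by uniform
  continuity of the cost.\<close>

lemma ternary_digits_eqI:
  fixes a b :: "nat \<Rightarrow> real"
  assumes a: "\<And>j. a j \<in> {0, 1}" and b: "\<And>j. b j \<in> {0, 1}"
    and close: "\<bar>(\<Sum>j. 2 * a j / 3 ^ Suc j) - (\<Sum>j. 2 * b j / 3 ^ Suc j)\<bar> < 1 / 3 ^ J"
    and "j < J"
  shows "a j = b j"
proof (rule ccontr)
  assume "a j \<noteq> b j"
  define i where "i = (LEAST i. a i \<noteq> b i)"
  have ne: "a i \<noteq> b i" and least: "\<And>k. k < i \<Longrightarrow> a k = b k"
    unfolding i_def using LeastI[of "\<lambda>i. a i \<noteq> b i", OF \<open>a j \<noteq> b j\<close>] not_less_Least by blast+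
  have "i \<le> j" unfolding i_def using \<open>a j \<noteq> b j\<close> by (rule Least_le)
  define d where "d k = 2 * a k / 3 ^ Suc k - 2 * b k / 3 ^ Suc k" for k
  have g: "(\<lambda>k. 2 / 3 ^ Suc k) sums (1::real)"
    using sums_mult[OF geometric_sums[of "1/3::real"], of "2/3"] by (simp add: power_divide)
  have absd: "\<bar>d k\<bar> \<le> 2 / 3 ^ Suc k" for k
    using a[of k] b[of k] by (auto simp: d_def)
  have sa: "summable (\<lambda>k. 2 * a k / 3 ^ Suc k)" 
  proof (rule summable_comparison_test'[OF sums_summable[OF g], of 0])
    show "norm (2 * a k / 3 ^ Suc k) \<le> 2 / 3 ^ Suc k" for k using a[of k] by auto
  qed
  have sb: "summable (\<lambda>k. 2 * b k / 3 ^ Suc k)"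
  proof (rule summable_comparison_test'[OF sums_summable[OF g], of 0])
    show "norm (2 * b k / 3 ^ Suc k) \<le> 2 / 3 ^ Suc k" for k using b[of k] by auto
  qed
  have sd: "summable d" unfolding d_def by (intro summable_diff sa sb)
  have "(\<Sum>k. 2 * a k / 3 ^ Suc k) - (\<Sum>k. 2 * b k / 3 ^ Suc k) = (\<Sum>k. d k)"
    unfolding d_def by (rule suminf_diff[OF sa sb])
  also have "\<dots> = (\<Sum>k. d (k + Suc i)) + (\<Sum>k<Suc i. d k)"
    by (rule suminf_split_initial_segment[OF sd])
  also have "(\<Sum>k<Suc i. d k) = d i"
    using least by (simp add: d_def)
  finally have eq: "(\<Sum>k. 2 * a k / 3 ^ Suc k) - (\<Sum>k. 2 * b k / 3 ^ Suc k) = (\<Sum>k. d (k + Suc i)) + d i" .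
  have gt: "(\<lambda>k. 2 / 3 ^ Suc (k + Suc i)) sums (1 / 3 ^ Suc i :: real)"
    using sums_mult[OF g, of "1 / 3 ^ Suc i"] by (simp add: power_add field_simps)
  have sabs: "summable (\<lambda>k. \<bar>d (k + Suc i)\<bar>)"
    by (rule summable_comparison_test'[OF sums_summable[OF gt], of 0])
       (simp only: real_norm_def abs_idempotent absd)
  have "\<bar>\<Sum>k. d (k + Suc i)\<bar> \<le> (\<Sum>k. \<bar>d (k + Suc i)\<bar>)"
    by (rule summable_rabs[OF sabs])
  also have "\<dots> \<le> (\<Sum>k. 2 / 3 ^ Suc (k + Suc i))"
    by (rule suminf_le[OF absd sabs sums_summable[OF gt]])
  also have "\<dots> = 1 / 3 ^ Suc i" using gt by (rule sums_unique[symmetric])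
  finally have tail: "\<bar>\<Sum>k. d (k + Suc i)\<bar> \<le> 1 / 3 ^ Suc i" .
  \<comment> \<open>The first differing digit contributes exactly 2/3^(i+1), while all later digits
    together contribute at most half of that.\<close>
  have "\<bar>d i\<bar> = 2 / 3 ^ Suc i"
    using a[of i] b[of i] ne by (auto simp: d_def)
  then have "1 / 3 ^ Suc i \<le> \<bar>(\<Sum>k. d (k + Suc i)) + d i\<bar>" using tail by (simp add: abs_if split: if_splits)
  moreover have "(1::real) / 3 ^ J \<le> 1 / 3 ^ Suc i"
    using \<open>i \<le> j\<close> \<open>j < J\<close> by (intro divide_left_mono power_increasing) auto
  ultimately show False using close eq by linarith
qed

text \<open>The code is the Cantor-type ternary expansion whose digits record membership in the balls of
  finite covers of radius \<open>1/(m+1)\<close>, \<open>m = 0, 1, \<dots>\<close>.\<close>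

lemma compact_real_code:
  fixes E :: "'e::metric_space set"
  assumes "compact E"
  obtains s :: "'e \<Rightarrow> real" where "s \<in> borel_measurable borel" "\<And>x. 0 \<le> s x" "\<And>x. s x \<le> 1"
    "\<And>\<epsilon>. \<epsilon> > 0 \<Longrightarrow> \<exists>\<delta>>0. \<forall>x\<in>E. \<forall>y\<in>E. \<bar>s x - s y\<bar> < \<delta> \<longrightarrow> dist x y < \<epsilon>"
proof -
  have "\<exists>p N. E \<subseteq> (\<Union>i<N::nat. ball (p i) (1 / Suc m))" for m
  proof -
    have "E \<subseteq> (\<Union>x\<in>E. ball x (1 / Suc m))" by auto
    then obtain T where T: "finite T" "E \<subseteq> (\<Union>x\<in>T. ball x (1 / Suc m))"
      using compactE_image[OF assms, of E "\<lambda>x. ball x (1 / Suc m)"] open_ball by metis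
    obtain p where "bij_betw p {0..<card T} T" using ex_bij_betw_nat_finite[OF T(1)] by blast
    then obtain n :: nat where n: "T = p ` {..<n}" by (auto simp: bij_betw_def lessThan_atLeast0)
    have "E \<subseteq> (\<Union>i<n. ball (p i) (1 / Suc m))" using T(2) unfolding n by simp
    then show ?thesis by blast
  qed
  then have "\<forall>m. \<exists>pN. E \<subseteq> (\<Union>i<snd pN::nat. ball (fst pN i) (1 / Suc m))"
    by (auto simp del: of_nat_Suc)
  from choice[OF this] obtain f :: "nat \<Rightarrow> (nat \<Rightarrow> 'e) \<times> nat"
    where f: "\<forall>m. E \<subseteq> (\<Union>i<snd (f m). ball (fst (f m) i) (1 / Suc m))" ..
  define p N where "p m = fst (f m)" and "N m = snd (f m)" for m
  have cover: "E \<subseteq> (\<Union>i<N m. ball (p m i) (1 / Suc m))" for m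
    unfolding p_def N_def using f by (rule spec)
  define U where "U j = (case prod_decode j of (m, i) \<Rightarrow> ball (p m i) (1 / Suc m))" for j
  have [measurable]: "U j \<in> sets borel" for j by (simp add: U_def split: prod.split)
  define s where "s x = (\<Sum>j. 2 * indicator (U j) x / 3 ^ Suc j :: real)" for x
  have g: "(\<lambda>k. 2 / 3 ^ Suc k) sums (1::real)"
    using sums_mult[OF geometric_sums[of "1/3::real"], of "2/3"] by (simp add: power_divide)
  have summ: "summable (\<lambda>j. 2 * indicator (U j) x / 3 ^ Suc j :: real)" for x
    by (rule summable_comparison_test'[OF sums_summable[OF g], of 0]) (auto simp: indicator_def)
  show ?thesis
  proof (rule that[of s])
    show "s \<in> borel_measurable borel" unfolding s_def by measurable
    show "0 \<le> s x" for x unfolding s_def by (rule suminf_nonneg[OF summ]) simp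
    have "s x \<le> (\<Sum>k. 2 / 3 ^ Suc k)" for x unfolding s_def
      by (rule suminf_le[OF _ summ sums_summable[OF g]]) (simp add: indicator_def)
    with g show "s x \<le> 1" for x by (simp add: sums_iff)
    fix \<epsilon> :: real assume "\<epsilon> > 0"
    then obtain m where m: "2 / Suc m < \<epsilon>"
      using reals_Archimedean[of "\<epsilon> / 2"] by (auto simp: field_simps)
    \<comment> \<open>\<open>J\<close> lies beyond every digit position that belongs to the
      \<open>m\<close>-th cover, so agreement of the first \<open>J\<close> digits means membership
      in the same balls of that cover.\<close>
    obtain J where J: "\<And>i. i < N m \<Longrightarrow> prod_encode (m, i) < J"
    proof
      fix i assume "i < N m"
      then have "prod_encode (m, i) \<le> Max ((\<lambda>i. prod_encode (m, i)) ` {..<N m})" by (intro Max_ge) auto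
      then show "prod_encode (m, i) < Suc (Max ((\<lambda>i. prod_encode (m, i)) ` {..<N m}))" by simp
    qed
    show "\<exists>\<delta>>0. \<forall>x\<in>E. \<forall>y\<in>E. \<bar>s x - s y\<bar> < \<delta> \<longrightarrow> dist x y < \<epsilon>"
    proof (intro exI[of _ "1 / 3 ^ J"] conjI ballI impI)
      fix x y assume xy: "x \<in> E" "y \<in> E" "\<bar>s x - s y\<bar> < 1 / 3 ^ J"
      obtain i where i: "i < N m" "x \<in> ball (p m i) (1 / Suc m)" using cover[of m] xy(1) by blast
      have "indicator (U (prod_encode (m, i))) x = (indicator (U (prod_encode (m, i))) y :: real)"
        by (rule ternary_digits_eqI[OF _ _ xy(3)[unfolded s_def] J[OF i(1)]]) (auto simp: indicator_def)
      with i have "y \<in> ball (p m i) (1 / Suc m)" by (simp add: U_def indicator_def split: if_splits)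
      with i have "dist x y < 1 / Suc m + 1 / Suc m"
        by (intro dist_triangle_less_add[of _ "p m i"]) (auto simp: dist_commute)
      with m show "dist x y < \<epsilon>" by simp
    qed simp
  qed
qed

text \<open>The hypothesis says that the inverse of \<open>s\<close> is uniformly continuous;
  \<open>s\<close> itself may be discontinuous, so its image need not be closed. The inverse extends
  to the closure because limits of preimages exist in the compact set \<open>E\<close>.\<close>

lemma uniformly_injective_left_inverse:
  fixes s :: "'e::metric_space \<Rightarrow> 'f::metric_space"
  assumes "compact E"
    and s: "\<And>\<epsilon>. \<epsilon> > 0 \<Longrightarrow> \<exists>\<delta>>0. \<forall>x\<in>E. \<forall>y\<in>E. dist (s x) (s y) < \<delta> \<longrightarrow> dist x y < \<epsilon>"
  obtains h where "continuous_on (closure (s ` E)) h" "h ` closure (s ` E) \<subseteq> E" "\<And>x. x \<in> E \<Longrightarrow> h (s x) = x"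
proof -
  \<comment> \<open>A cluster point of preimages of codes tending to \<open>z\<close> works: the
    modulus of \<open>s\<close> draws every point of \<open>E\<close> with code near
    \<open>z\<close> towards it. This approximation property then serves to define
    \<open>h\<close>.\<close>
  have ex: "\<exists>x\<in>E. \<forall>\<epsilon>>0. \<exists>\<delta>>0. \<forall>y\<in>E. dist (s y) z < \<delta> \<longrightarrow> dist x y < \<epsilon>" if "z \<in> closure (s ` E)" for z
  proof -
    obtain u where u: "\<And>n. u n \<in> E" "(\<lambda>n. s (u n)) \<longlonglongrightarrow> z"
    proof -
      have "\<exists>w. (\<forall>n. w n \<in> s ` E) \<and> w \<longlonglongrightarrow> z" using \<open>z \<in> closure (s ` E)\<close> unfolding closure_sequential .
      then obtain w where w: "\<And>n. w n \<in> s ` E" "w \<longlonglongrightarrow> z" by blast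
      from w(1) have "\<forall>n. \<exists>u. u \<in> E \<and> w n = s u" by blast
      then obtain u where u: "\<And>n. u n \<in> E \<and> w n = s (u n)" by metis
      then have "w = (\<lambda>n. s (u n))" by auto
      with w(2) u show ?thesis by (intro that[of u]) auto
    qed
    obtain x r where x: "x \<in> E" "strict_mono (r::nat\<Rightarrow>nat)" "(u \<circ> r) \<longlonglongrightarrow> x"
      using \<open>compact E\<close> u(1) unfolding compact_def by metis
    have "\<exists>\<delta>>0. \<forall>y\<in>E. dist (s y) z < \<delta> \<longrightarrow> dist x y < \<epsilon>" if "\<epsilon> > 0" for \<epsilon>
    proof -
      obtain \<delta> where \<delta>: "\<delta> > 0" "\<And>x y. x \<in> E \<Longrightarrow> y \<in> E \<Longrightarrow> dist (s x) (s y) < \<delta> \<Longrightarrow> dist x y < \<epsilon> / 2"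
        using s[of "\<epsilon> / 2"] \<open>\<epsilon> > 0\<close> by auto
      have "\<forall>\<^sub>F n in sequentially. dist ((u \<circ> r) n) x < \<epsilon> / 2"
        by (rule tendstoD[OF x(3)]) (use \<open>\<epsilon> > 0\<close> in simp)
      moreover have "\<forall>\<^sub>F n in sequentially. dist (((\<lambda>n. s (u n)) \<circ> r) n) z < \<delta> / 2"
        by (rule tendstoD[OF LIMSEQ_subseq_LIMSEQ[OF u(2) x(2)]]) (use \<delta>(1) in simp)
      ultimately have "\<forall>\<^sub>F n in sequentially. dist (u (r n)) x < \<epsilon> / 2 \<and> dist (s (u (r n))) z < \<delta> / 2"
        by eventually_elim simp
      then obtain n where n: "dist (u (r n)) x < \<epsilon> / 2" "dist (s (u (r n))) z < \<delta> / 2"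
        using eventually_happens'[OF sequentially_bot] by blast
      have "dist x y < \<epsilon>" if "y \<in> E" "dist (s y) z < \<delta> / 2" for y
      proof -
        have "dist (s (u (r n))) (s y) < \<delta>"
          using n(2) that(2) by (rule dist_triangle_half_l)
        then have "dist (u (r n)) y < \<epsilon> / 2" by (rule \<delta>(2)[OF u(1) that(1)])
        moreover have "dist x y \<le> dist (u (r n)) x + dist (u (r n)) y" by (rule dist_triangle3)
        ultimately show ?thesis using n(1) by linarith
      qed
      then show ?thesis using \<delta>(1) by (intro exI[of _ "\<delta> / 2"]) auto
    qed
    with x(1) show ?thesis by blast
  qed
  define h where "h z = (SOME x. x \<in> E \<and> (\<forall>\<epsilon>>0. \<exists>\<delta>>0. \<forall>y\<in>E. dist (s y) z < \<delta> \<longrightarrow> dist x y < \<epsilon>))" for z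
  have "h z \<in> E \<and> (\<forall>\<epsilon>>0. \<exists>\<delta>>0. \<forall>y\<in>E. dist (s y) z < \<delta> \<longrightarrow> dist (h z) y < \<epsilon>)"
    if "z \<in> closure (s ` E)" for z
    unfolding h_def by (rule someI_ex) (use ex[OF that] in \<open>simp only: Bex_def\<close>)
  then have h: "\<And>z. z \<in> closure (s ` E) \<Longrightarrow> h z \<in> E"
      "\<And>z \<epsilon>. z \<in> closure (s ` E) \<Longrightarrow> \<epsilon> > 0 \<Longrightarrow> \<exists>\<delta>>0. \<forall>y\<in>E. dist (s y) z < \<delta> \<longrightarrow> dist (h z) y < \<epsilon>"
    by simp_all
  show ?thesis
  proof (rule that[of h])
    show "h ` closure (s ` E) \<subseteq> E" using h(1) by blast
    show "h (s x) = x" if "x \<in> E" for x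
    proof (rule ccontr)
      assume "h (s x) \<noteq> x"
      then have "dist (h (s x)) x > 0" by simp
      moreover have "s x \<in> closure (s ` E)" using \<open>x \<in> E\<close> by (intro subsetD[OF closure_subset] imageI)
      ultimately obtain \<delta> where \<delta>: "\<delta> > 0"
          "\<forall>y\<in>E. dist (s y) (s x) < \<delta> \<longrightarrow> dist (h (s x)) y < dist (h (s x)) x"
        using h(2) by blast
      from \<delta>(2) \<open>x \<in> E\<close> have "dist (s x) (s x) < \<delta> \<longrightarrow> dist (h (s x)) x < dist (h (s x)) x" by (rule bspec)
      with \<delta>(1) show False by simp
    qed
    show "continuous_on (closure (s ` E)) h"
      unfolding continuous_on_iff
    proof (intro ballI allI impI)
      fix z and \<epsilon> :: real assume z: "z \<in> closure (s ` E)" and "\<epsilon> > 0"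
      obtain \<delta> where \<delta>: "\<delta> > 0" "\<And>y. y \<in> E \<Longrightarrow> dist (s y) z < \<delta> \<Longrightarrow> dist (h z) y < \<epsilon> / 2"
        using h(2)[OF z, of "\<epsilon> / 2"] \<open>\<epsilon> > 0\<close> by auto
      have "dist (h z') (h z) < \<epsilon>" if z': "z' \<in> closure (s ` E)" "dist z' z < \<delta> / 2" for z'
      proof -
        obtain \<delta>' where \<delta>': "\<delta>' > 0" "\<And>y. y \<in> E \<Longrightarrow> dist (s y) z' < \<delta>' \<Longrightarrow> dist (h z') y < \<epsilon> / 2"
          using h(2)[OF z'(1), of "\<epsilon> / 2"] \<open>\<epsilon> > 0\<close> by auto
        \<comment> \<open>A point of \<open>E\<close> whose code is near both \<open>z\<close> and
          \<open>z'\<close> compares the two values of \<open>h\<close>.\<close>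
        obtain y where y: "y \<in> E" "dist (s y) z' < min \<delta>' (\<delta> / 2)"
        proof -
          have "min \<delta>' (\<delta> / 2) > 0" using \<delta>(1) \<delta>'(1) by simp
          with z'(1) have "\<exists>w\<in>s ` E. dist w z' < min \<delta>' (\<delta> / 2)" unfolding closure_approachable by blast
          then show ?thesis using that by blast
        qed
        have "dist (s y) z \<le> dist (s y) z' + dist z' z" by (rule dist_triangle)
        then have "dist (s y) z < \<delta>" using y(2) z'(2) by linarith
        then have "dist (h z) y < \<epsilon> / 2" by (rule \<delta>(2)[OF y(1)])
        moreover have "dist (h z') y < \<epsilon> / 2" using y by (intro \<delta>'(2)) linarith+
        moreover have "dist (h z') (h z) \<le> dist (h z') y + dist (h z) y" by (rule dist_triangle2)
        ultimately show ?thesis by linarith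
      qed
      then show "\<exists>d>0. \<forall>x'\<in>closure (s ` E). dist x' z < d \<longrightarrow> dist (h x') (h z) < \<epsilon>"
        using \<delta>(1) by (intro exI[of _ "\<delta> / 2"]) auto
    qed
  qed
qed

section \<open>Almost sure representation of weak limits on compact sets\<close>

text \<open>The ambient types need not be separable, so the product sigma-algebra may be strictly smaller
  than the Borel sigma-algebra of the product topology. On a compact set the traces of the two agree,
  which is all that is needed.\<close>

definition borel_on :: "'e::metric_space set \<Rightarrow> 'e measure \<Rightarrow> bool" where
  "borel_on E M \<longleftrightarrow> compact E \<and> E \<in> sets M \<and> sets (restrict_space M E) = sets (restrict_space borel E)"

text \<open>The base in the last hypothesis may be uncountable: a relatively open subset of a
  compact metric space is a countable union of compact sets, and each of these is covered by
  finitely many base sets.\<close>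

lemma borel_onI:
  fixes E :: "'e::metric_space set"
  assumes "compact E" "E \<in> sets M" and id: "(\<lambda>x. x) \<in> measurable (restrict_space borel E) M"
    and basis: "\<And>U x. open U \<Longrightarrow> x \<in> U \<Longrightarrow> x \<in> E \<Longrightarrow> \<exists>V. open V \<and> x \<in> V \<and> V \<subseteq> U \<and> V \<inter> E \<in> sets M"
  shows "borel_on E M"
  unfolding borel_on_def
proof (intro conjI assms(1,2) equalityI subsetI)
  fix A assume "A \<in> sets (restrict_space M E)"
  then obtain B where B: "B \<in> sets M" "A = E \<inter> B" by (auto simp: sets_restrict_space)
  have "(\<lambda>x. x) -` B \<inter> space (restrict_space borel E) \<in> sets (restrict_space borel E)"
    by (rule measurable_sets[OF id B(1)])
  then show "A \<in> sets (restrict_space borel E)" by (simp add: B(2) space_restrict_space Int_commute)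
next
  have open_M: "E \<inter> U \<in> sets M" if "open U" for U
  proof -
    \<comment> \<open>Points of \<open>E\<close> at distance at least 1/(n+1) from every point
      outside \<open>U\<close>. As \<open>E\<close> minus an open set this is compact, and these
      sets exhaust the part of \<open>E\<close> in \<open>U\<close>.\<close>
    define F where "F n = E - (\<Union>y\<in>-U. ball y (1 / Suc n))" for n :: nat
    have "\<exists>V. F n \<subseteq> V \<and> V \<subseteq> U \<and> V \<inter> E \<in> sets M" for n
    proof -
      have FU: "x \<in> U" if "x \<in> F n" for x
      proof (rule ccontr)
        assume "x \<notin> U"
        then have "x \<in> (\<Union>y\<in>-U. ball y (1 / Suc n))" by (intro UN_I[of x]) auto
        with that show False by (simp add: F_def)
      qed
      have "compact (F n)" unfolding F_def by (intro compact_diff \<open>compact E\<close> open_UN) auto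
      have "\<exists>V. open V \<and> x \<in> V \<and> V \<subseteq> U \<and> V \<inter> E \<in> sets M" if "x \<in> F n" for x
        using FU[OF that] that by (intro basis \<open>open U\<close>) (auto simp: F_def)
      then have "\<forall>x\<in>F n. \<exists>V. open V \<and> x \<in> V \<and> V \<subseteq> U \<and> V \<inter> E \<in> sets M" by (rule ballI)
      from bchoice[OF this] obtain V
        where V: "\<forall>x\<in>F n. open (V x) \<and> x \<in> V x \<and> V x \<subseteq> U \<and> V x \<inter> E \<in> sets M" ..
      obtain T where T: "T \<subseteq> F n" "finite T" "F n \<subseteq> (\<Union>x\<in>T. V x)"
      proof (rule compactE_image[OF \<open>compact (F n)\<close>, of "F n" V])
        show "open (V x)" if "x \<in> F n" for x using V that by blast
        show "F n \<subseteq> (\<Union>x\<in>F n. V x)" using V by blast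
      qed
      have "(\<Union>x\<in>T. V x) \<inter> E = (\<Union>x\<in>T. V x \<inter> E)" by blast
      also have "\<dots> \<in> sets M" using T V by (intro sets.finite_UN) auto
      finally show ?thesis using T V by (intro exI[of _ "\<Union>x\<in>T. V x"]) blast
    qed
    then have "\<forall>n. \<exists>V. F n \<subseteq> V \<and> V \<subseteq> U \<and> V \<inter> E \<in> sets M" by (rule allI)
    from choice[OF this] obtain V where "\<forall>n. F n \<subseteq> V n \<and> V n \<subseteq> U \<and> V n \<inter> E \<in> sets M" ..
    then have V: "\<And>n. F n \<subseteq> V n" "\<And>n. V n \<subseteq> U" "\<And>n. V n \<inter> E \<in> sets M" by simp_all
    have inF: "\<exists>n. x \<in> F n" if "x \<in> E" "x \<in> U" for x
    proof -
      obtain e where e: "e > 0" "\<And>y. dist y x < e \<Longrightarrow> y \<in> U" using \<open>open U\<close> \<open>x \<in> U\<close> by (auto simp: open_dist)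
      obtain n where n: "inverse (Suc n) < e" using e(1) reals_Archimedean by blast
      have "x \<notin> ball y (1 / Suc n)" if "y \<notin> U" for y
      proof
        assume "x \<in> ball y (1 / Suc n)"
        then have "dist y x < inverse (Suc n)" by (simp add: inverse_eq_divide)
        with n have "dist y x < e" by linarith
        with e(2) \<open>y \<notin> U\<close> show False by blast
      qed
      with \<open>x \<in> E\<close> show ?thesis unfolding F_def by blast
    qed
    have "E \<inter> U \<subseteq> (\<Union>n. V n \<inter> E)"
    proof
      fix x assume x: "x \<in> E \<inter> U"
      then obtain n where "x \<in> F n" using inF by blast
      with V(1) have "x \<in> V n" by (rule subsetD)
      with x show "x \<in> (\<Union>n. V n \<inter> E)" by auto
    qed
    moreover have "(\<Union>n. V n \<inter> E) \<subseteq> E \<inter> U" using V(2) by auto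
    ultimately have "E \<inter> U = (\<Union>n. V n \<inter> E)" by (rule equalityI)
    also have "\<dots> \<in> sets M" using V(3) by (intro sets.countable_UN) auto
    finally show ?thesis .
  qed
  have id': "(\<lambda>x. x) \<in> borel_measurable (restrict_space M E)"
  proof (rule borel_measurableI)
    fix U :: "'e set" assume "open U"
    have "(\<lambda>x. x) -` U \<inter> space (restrict_space M E) = E \<inter> (E \<inter> U)"
      using \<open>E \<in> sets M\<close> by auto
    also have "\<dots> \<in> sets (restrict_space M E)"
      unfolding sets_restrict_space by (rule imageI) (rule open_M[OF \<open>open U\<close>])
    finally show "(\<lambda>x. x) -` U \<inter> space (restrict_space M E) \<in> sets (restrict_space M E)" .
  qed
  fix A assume "A \<in> sets (restrict_space borel E)"
  then obtain B where B: "B \<in> sets borel" "A = E \<inter> B" by (auto simp: sets_restrict_space)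
  have "(\<lambda>x. x) -` B \<inter> space (restrict_space M E) \<in> sets (restrict_space M E)"
    by (rule measurable_sets[OF id' B(1)])
  then show "A \<in> sets (restrict_space M E)"
    using \<open>E \<in> sets M\<close> by (simp add: B(2) Int_commute)
qed

lemma borel_on_borel: "compact E \<Longrightarrow> borel_on E borel"
  by (simp add: borel_on_def borel_compact)

text \<open>A map that is Borel on \<open>E\<close> alone becomes measurable for the possibly
  smaller sigma-algebra \<open>M\<close> once it is constant off \<open>E\<close>. The coding map,
  the costs and the barycentre map all enter through this extension.\<close>

lemma borel_on_measurable:
  assumes E: "borel_on E M" and f: "f \<in> measurable (restrict_space borel E) N" and c: "c \<in> space N"
  shows "(\<lambda>x. if x \<in> E then f x else c) \<in> measurable M N"
proof -
  have "f \<in> measurable (restrict_space M E) N"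
    using f E measurable_cong_sets[of "restrict_space M E" "restrict_space borel E" N N]
    by (simp add: borel_on_def)
  moreover have "E \<inter> space M \<in> sets M" using E by (simp add: borel_on_def)
  ultimately show ?thesis by (simp only: measurable_restrict_space_iff[OF _ c])
qed

lemma borel_on_measurable_into:
  assumes E: "borel_on E M" and f: "f \<in> measurable N borel" "\<And>x. x \<in> space N \<Longrightarrow> f x \<in> E"
  shows "f \<in> measurable N M"
proof -
  have "f \<in> measurable N (restrict_space borel E)"
    using f by (intro measurable_restrict_space2) auto
  then have "f \<in> measurable N (restrict_space M E)"
    using E measurable_cong_sets[of N N "restrict_space M E" "restrict_space borel E"]
    by (simp add: borel_on_def)
  then show ?thesis by (simp add: measurable_restrict_space2_iff)
qed

text \<open>Prokhorov's and Skorokhod's theorems at once: the real codes have a weakly convergent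
  subsequence by Helly's theorem, and decoding Skorokhod's real random variables is continuous.\<close>

lemma skorohod_compact:
  fixes E :: "'e::metric_space set" and M :: "'e measure"
  assumes E: "borel_on E M" and N: "\<And>n. prob_space (N n)" "\<And>n. sets (N n) = sets M"
    "\<And>n::nat. AE x in N n. x \<in> E"
  obtains \<Omega> :: "real measure" and r Z W where "prob_space \<Omega>" "strict_mono r"
    "\<And>n. Z n \<in> measurable \<Omega> M" "\<And>n. distr \<Omega> M (Z n) = N (r n)" "\<And>n \<omega>. Z n \<omega> \<in> E"
    "W \<in> measurable \<Omega> M" "\<And>\<omega>. W \<omega> \<in> E" "AE \<omega> in \<Omega>. (\<lambda>n. Z n \<omega>) \<longlonglongrightarrow> W \<omega>"
proof -
  interpret N: prob_space "N n" for n by (rule N)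
  have "E \<noteq> {}" using N(3)[of 0] N.AE_False by auto
  then obtain e where e: "e \<in> E" by blast
  have "compact E" using E by (simp add: borel_on_def)
  obtain s :: "'e \<Rightarrow> real" where s: "s \<in> borel_measurable borel" "\<And>x. 0 \<le> s x" "\<And>x. s x \<le> 1"
    "\<And>\<epsilon>. \<epsilon> > 0 \<Longrightarrow> \<exists>\<delta>>0. \<forall>x\<in>E. \<forall>y\<in>E. \<bar>s x - s y\<bar> < \<delta> \<longrightarrow> dist x y < \<epsilon>"
    using compact_real_code[OF \<open>compact E\<close>] by blast
  define C where "C = closure (s ` E)"
  obtain h where h: "continuous_on C h" "h ` C \<subseteq> E" "\<And>x. x \<in> E \<Longrightarrow> h (s x) = x"
    using uniformly_injective_left_inverse[OF \<open>compact E\<close>, of s] s(4) unfolding C_def dist_real_def by blast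
  have sC: "s x \<in> C" if "x \<in> E" for x
    unfolding C_def using that by (intro subsetD[OF closure_subset] imageI)
  have "closed C" by (simp add: C_def)
  \<comment> \<open>The default values keep the codes in \<open>C\<close> and the decoded points in
    \<open>E\<close> everywhere, not merely almost everywhere.\<close>
  define s' where "s' x = (if x \<in> E then s x else s e)" for x
  define h' where "h' z = (if z \<in> C then h z else e)" for z
  have s': "s' \<in> borel_measurable M"
    unfolding s'_def by (rule borel_on_measurable[OF E measurable_restrict_space1[OF s(1)]]) simp
  have h'E: "h' z \<in> E" for z using h(2) e by (auto simp: h'_def)
  have "h' \<in> borel_measurable borel"
    unfolding h'_def using \<open>closed C\<close> by (intro borel_measurable_continuous_on_if h(1)) auto
  then have h': "h' \<in> measurable borel M"
    by (rule borel_on_measurable_into[OF E]) (rule h'E)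
  define L where "L n = distr (N n) borel s'" for n
  have s'N: "s' \<in> borel_measurable (N n)" for n
    using s' by (subst measurable_cong_sets[OF N(2) refl])
  have L: "real_distribution (L n)" for n unfolding L_def by (rule N.real_distribution_distr[OF s'N])
  \<comment> \<open>Codes lie in [0,1], so one bounded half-open interval carries every
    \<open>L n\<close> and tightness is immediate.\<close>
  have "measure (L n) {-1<..2} = 1" for n
  proof -
    have "-1 < s' x \<and> s' x \<le> 2" for x using s(2)[of x] s(3)[of x] s(2)[of e] s(3)[of e] by (simp add: s'_def)
    then have "s' -` {-1<..2} \<inter> space (N n) = space (N n)" by auto
    then show ?thesis by (simp add: L_def measure_distr s'N N.prob_space)
  qed
  then have "\<forall>\<epsilon>>0. - 1 < (2::real) \<and> (\<forall>n. measure (L n) {- 1<..2} > 1 - \<epsilon>)" by simp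
  then have "tight L" unfolding tight_def using L by blast
  moreover have "strict_mono (\<lambda>n::nat. n)" by (simp add: strict_mono_def)
  ultimately have "\<exists>r M. strict_mono (r :: nat \<Rightarrow> nat) \<and> real_distribution M \<and> weak_conv_m (L \<circ> (\<lambda>n. n) \<circ> r) M"
    by (rule tight_imp_convergent_subsubsequence)
  then obtain r :: "nat \<Rightarrow> nat" and Q
    where r: "strict_mono r" "real_distribution Q" "weak_conv_m (\<lambda>n. L (r n)) Q"
    unfolding comp_def by blast
  obtain \<Omega> :: "real measure" and Y_seq Y where Y: "prob_space \<Omega>" "\<And>n. Y_seq n \<in> measurable \<Omega> borel"
    "\<And>n. distr \<Omega> borel (Y_seq n) = L (r n)" "Y \<in> measurable \<Omega> lborel"
    "\<And>\<omega>. \<omega> \<in> space \<Omega> \<Longrightarrow> (\<lambda>n. Y_seq n \<omega>) \<longlonglongrightarrow> Y \<omega>"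
    using Skorohod[OF L r(2,3)] by blast
  have Ym: "Y \<in> borel_measurable \<Omega>" using Y(4) by simp
  \<comment> \<open>\<open>C\<close> is closed, hence measurable and closed under limits: almost
    surely the whole sequence and its limit stay where the decoder \<open>h\<close> is
    continuous.\<close>
  have "AE \<omega> in \<Omega>. Y_seq n \<omega> \<in> C" for n
  proof -
    have "AE x in L (r n). x \<in> C"
      unfolding L_def using sC e \<open>closed C\<close> by (subst AE_distr_iff[OF s'N]) (auto simp: s'_def)
    then show ?thesis
      unfolding Y(3)[symmetric] using \<open>closed C\<close> by (subst (asm) AE_distr_iff[OF Y(2)]) auto
  qed
  then have "AE \<omega> in \<Omega>. \<forall>n. Y_seq n \<omega> \<in> C" by (simp add: AE_all_countable)
  then have conv: "AE \<omega> in \<Omega>. (\<lambda>n. h' (Y_seq n \<omega>)) \<longlonglongrightarrow> h' (Y \<omega>)"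
  proof (rule AE_mp, intro AE_I2 impI)
    fix \<omega> assume \<omega>: "\<omega> \<in> space \<Omega>" "\<forall>n. Y_seq n \<omega> \<in> C"
    have "Y \<omega> \<in> C"
      using closed_sequentially[OF \<open>closed C\<close> _ Y(5)[OF \<omega>(1)]] \<omega>(2) by blast
    then show "(\<lambda>n. h' (Y_seq n \<omega>)) \<longlonglongrightarrow> h' (Y \<omega>)"
      using \<omega>(2) continuous_on_tendsto_compose[OF h(1) Y(5)[OF \<omega>(1)]] by (simp add: h'_def)
  qed
  have law: "distr \<Omega> M (\<lambda>\<omega>. h' (Y_seq n \<omega>)) = N (r n)" for n
  proof -
    have "distr \<Omega> M (\<lambda>\<omega>. h' (Y_seq n \<omega>)) = distr (distr \<Omega> borel (Y_seq n)) M h'"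
      by (simp add: distr_distr[OF h' Y(2)] comp_def)
    also have "\<dots> = distr (N (r n)) M (\<lambda>x. h' (s' x))"
      by (simp add: Y(3) L_def distr_distr[OF h' s'N] comp_def)
    \<comment> \<open>Decoding undoes coding on \<open>E\<close>, which has full mass under
      \<open>N (r n)\<close>.\<close>
    also have "\<dots> = distr (N (r n)) (N (r n)) (\<lambda>x. x)"
    proof (rule distr_cong_AE)
      show "AE x in N (r n). h' (s' x) = x"
        using N(3)[of "r n"] by eventually_elim (simp add: h'_def s'_def sC h(3))
      show "(\<lambda>x. h' (s' x)) \<in> measurable (N (r n)) M"
        using s'N h' by (rule measurable_compose)
    qed (auto simp: N(2))
    finally show ?thesis by (simp add: distr_id)
  qed
  show ?thesis
    by (rule that[OF Y(1) r(1), of "\<lambda>n \<omega>. h' (Y_seq n \<omega>)" "\<lambda>\<omega>. h' (Y \<omega>)"])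
       (use law conv h'E in \<open>auto intro: measurable_compose[OF Y(2) h'] measurable_compose[OF Ym h']\<close>)
qed

lemma borel_on_open:
  assumes "borel_on E M" "open U"
  shows "U \<inter> E \<in> sets M"
proof -
  have "E \<inter> U \<in> sets (restrict_space borel E)"
    unfolding sets_restrict_space using \<open>open U\<close> by (intro imageI) auto
  then have "E \<inter> U \<in> sets (restrict_space M E)" using assms(1) by (simp add: borel_on_def)
  moreover have "E \<inter> space M \<in> sets M" using assms(1) by (simp add: borel_on_def)
  ultimately show ?thesis by (simp add: sets_restrict_space_iff Int_commute)
qed

lemma borel_on_pair:
  fixes X :: "'a::metric_space set" and Y :: "'b::metric_space set"
  assumes X: "borel_on X M" and Y: "borel_on Y N"
  shows "borel_on (X \<times> Y) (M \<Otimes>\<^sub>M N)"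
proof (rule borel_onI)
  show "compact (X \<times> Y)" using X Y by (simp add: borel_on_def compact_Times)
  show "X \<times> Y \<in> sets (M \<Otimes>\<^sub>M N)" using X Y by (simp add: borel_on_def)
  let ?R = "restrict_space borel (X \<times> Y)"
  have "(fst :: 'a \<times> 'b \<Rightarrow> 'a) \<in> borel_measurable borel" "(snd :: 'a \<times> 'b \<Rightarrow> 'b) \<in> borel_measurable borel"
    by (intro borel_measurable_continuous_onI continuous_intros)+
  then have "fst \<in> borel_measurable ?R" "snd \<in> borel_measurable ?R"
    by (simp_all only: measurable_restrict_space1)
  then have "fst \<in> measurable ?R M" "snd \<in> measurable ?R N"
    using borel_on_measurable_into[OF X, of fst ?R] borel_on_measurable_into[OF Y, of snd ?R]
    by (auto simp: space_restrict_space)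
  then have "(\<lambda>x. (fst x, snd x)) \<in> measurable ?R (M \<Otimes>\<^sub>M N)" by (rule measurable_Pair)
  then show "(\<lambda>x. x) \<in> measurable ?R (M \<Otimes>\<^sub>M N)" by simp
next
  fix U :: "('a \<times> 'b) set" and p assume "open U" "p \<in> U" "p \<in> X \<times> Y"
  then obtain A B where AB: "open A" "open B" "p \<in> A \<times> B" "A \<times> B \<subseteq> U" using open_prod_elim by blast
  have "(A \<times> B) \<inter> (X \<times> Y) = (A \<inter> X) \<times> (B \<inter> Y)" by blast
  also have "\<dots> \<in> sets (M \<Otimes>\<^sub>M N)" by (intro pair_measureI borel_on_open[OF X] borel_on_open[OF Y] AB)
  finally show "\<exists>V. open V \<and> p \<in> V \<and> V \<subseteq> U \<and> V \<inter> (X \<times> Y) \<in> sets (M \<Otimes>\<^sub>M N)"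
    using AB by (intro exI[of _ "A \<times> B"] conjI open_Times) auto
qed

text \<open>The topology on functions is the product over all indices, whereas the sigma-algebra
  sees only those in \<open>I\<close>. Extensional functions are pinned to \<open>undefined\<close>
  off \<open>I\<close>, so on this set the remaining coordinates carry no information.\<close>

lemma borel_on_PiE:
  fixes Y :: "'i::countable \<Rightarrow> 'b::metric_space set"
  assumes I: "finite I" and Y: "\<And>i. i \<in> I \<Longrightarrow> compact (Y i)"
  shows "borel_on (PiE I Y) (PiM I (\<lambda>_. borel))"
proof (rule borel_onI)
  \<comment> \<open>Singleton factors outside \<open>I\<close> turn the extensional product into a
    full product, to which Tychonoff's theorem applies.\<close>
  define Y' where "Y' i = (if i \<in> I then Y i else {undefined})" for i
  have PiE_eq: "PiE I Y = PiE UNIV Y'"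
    by (auto simp: Y'_def PiE_iff extensional_def split: if_splits)
  have "compactin (product_topology (\<lambda>i. euclidean) UNIV) (PiE UNIV Y')"
    unfolding compactin_PiE using Y by (simp add: Y'_def)
  then show "compact (PiE I Y)" by (simp add: PiE_eq euclidean_product_topology)
  show "PiE I Y \<in> sets (PiM I (\<lambda>_. borel))"
    using Y by (intro sets_PiM_I_finite I) (auto intro: borel_compact)
  let ?R = "restrict_space borel (PiE I Y)"
  have "(\<lambda>f. \<lambda>i\<in>I. f i) \<in> measurable ?R (PiM I (\<lambda>_. borel))"
  proof (rule measurable_restrict)
    fix i assume "i \<in> I"
    have "(\<lambda>f::'i \<Rightarrow> 'b. f i) \<in> borel_measurable borel"
      by (intro borel_measurable_continuous_onI continuous_on_product_coordinates)
    then show "(\<lambda>f. f i) \<in> borel_measurable ?R" by (rule measurable_restrict_space1)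
  qed
  then show "(\<lambda>f. f) \<in> measurable ?R (PiM I (\<lambda>_. borel))"
    by (rule measurable_cong[THEN iffD1, rotated]) (auto simp: space_restrict_space)
next
  fix U :: "('i \<Rightarrow> 'b) set" and f assume U: "open U" "f \<in> U" "f \<in> PiE I Y"
  from product_topology_open_contains_basis[OF U(1)[unfolded open_fun_def] U(2)]
  obtain S where S: "f \<in> PiE UNIV S" "\<And>i. open (S i)" "finite {i. S i \<noteq> UNIV}" "PiE UNIV S \<subseteq> U"
    by auto
  have "PiE UNIV S \<inter> PiE I Y = PiE I (\<lambda>i. S i \<inter> Y i)"
  proof (intro equalityI subsetI)
    fix g assume "g \<in> PiE I (\<lambda>i. S i \<inter> Y i)"
    moreover have "g i \<in> S i" if "i \<notin> I" for i
    proof -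
      have "g i = f i" using that U(3) calculation by (auto simp: PiE_iff extensional_def)
      with S(1) show ?thesis by auto
    qed
    ultimately show "g \<in> PiE UNIV S \<inter> PiE I Y" by (auto simp: PiE_iff)
  qed (auto simp: PiE_iff)
  also have "\<dots> \<in> sets (PiM I (\<lambda>_. borel))"
    using S(2) Y by (intro sets_PiM_I_finite I sets.Int borel_open borel_compact)
  finally show "\<exists>V. open V \<and> f \<in> V \<and> V \<subseteq> U \<and> V \<inter> PiE I Y \<in> sets (PiM I (\<lambda>_. borel))"
    using S by (intro exI[of _ "PiE UNIV S"] conjI open_PiE) auto
qed

section \<open>Partitions into small cells, and measures determined by continuous integrals\<close>

lemma compact_fine_cells:
  fixes X :: "'a::metric_space set"
  assumes "compact X" "\<delta> > 0"
  obtains a :: "'a \<Rightarrow> nat" where "a \<in> measurable borel (count_space UNIV)"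
    "\<And>x y. x \<in> X \<Longrightarrow> y \<in> X \<Longrightarrow> a x = a y \<Longrightarrow> dist x y < \<delta>"
proof -
  have "X \<subseteq> (\<Union>x\<in>X. ball x (\<delta> / 2))" using \<open>\<delta> > 0\<close> by auto
  then obtain T where T: "finite T" "X \<subseteq> (\<Union>x\<in>T. ball x (\<delta> / 2))"
    using compactE_image[OF \<open>compact X\<close>, of X "\<lambda>x. ball x (\<delta> / 2)"] open_ball by metis
  obtain p where "bij_betw p {0..<card T} T" using ex_bij_betw_nat_finite[OF T(1)] by blast
  then obtain n :: nat where n: "T = p ` {..<n}" by (auto simp: bij_betw_def lessThan_atLeast0)
  \<comment> \<open>Index of the first ball that contains \<open>x\<close>. Centres
    \<open>p i\<close> beyond the finite cover are harmless: only the distance of \<open>x\<close>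
    to its own centre \<open>p (a x)\<close> matters.\<close>
  define a where "a x = (LEAST i. x \<in> ball (p i) (\<delta> / 2))" for x
  have a: "dist (p (a x)) x < \<delta> / 2" if "x \<in> X" for x
  proof -
    have "\<exists>i. x \<in> ball (p i) (\<delta> / 2)" using that T(2) unfolding n by blast
    from LeastI_ex[OF this] show ?thesis by (simp add: a_def)
  qed
  show ?thesis
  proof (rule that[of a])
    have "Measurable.pred borel (\<lambda>x. x \<in> ball (p i) (\<delta> / 2))" for i
      unfolding pred_def using borel_open[OF open_ball, of "p i" "\<delta> / 2"] by (simp del: mem_ball)
    then show "a \<in> measurable borel (count_space UNIV)" unfolding a_def by (rule measurable_Least)
    fix x y assume "x \<in> X" "y \<in> X" "a x = a y"
    then have "dist (p (a x)) x < \<delta> / 2" "dist (p (a x)) y < \<delta> / 2" using a[of x] a[of y] by simp_all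
    moreover have "dist x y \<le> dist (p (a x)) x + dist (p (a x)) y" by (rule dist_triangle3)
    ultimately show "dist x y < \<delta>" by linarith
  qed
qed

text \<open>Closed sets form an intersection-stable generator of the Borel sets, and the indicator
  of a nonempty closed set is the pointwise limit of truncated multiples of the distance
  function.\<close>

lemma prob_eqI_continuous_integrals:
  fixes M N :: "'a::metric_space measure"
  assumes M: "prob_space M" "sets M = sets borel" and N: "prob_space N" "sets N = sets borel"
    and eq: "\<And>f::'a \<Rightarrow> real. continuous_on UNIV f \<Longrightarrow> (\<integral>x. f x \<partial>M) = (\<integral>x. f x \<partial>N)"
  shows "M = N"
proof -
  interpret M: prob_space M by fact
  interpret N: prob_space N by fact
  have closed_eq: "emeasure M C = emeasure N C" if "closed C" for C
  \<comment> \<open>The empty set is split off because \<open>infdist\<close> to it is 0 by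
    convention, which would make the approximating functions constantly 1.\<close>
  proof (cases "C = {}")
    case False
    define f where "f n x = max 0 (1 - real n * infdist x C)" for n x
    have cont: "continuous_on UNIV (f n)" for n unfolding f_def by (intro continuous_intros)
    then have fm: "f n \<in> borel_measurable borel" for n by (rule borel_measurable_continuous_onI)
    have conv: "(\<lambda>n. f n x) \<longlonglongrightarrow> indicator C x" for x
    proof (cases "x \<in> C")
      case True
      then show ?thesis by (simp add: f_def)
    next
      case xC: False
      then have "infdist x C > 0" using in_closed_iff_infdist_zero[OF \<open>closed C\<close> False] infdist_nonneg[of x C] by force
      then obtain k where k: "real k * infdist x C > 1" using reals_Archimedean3 by blast
      have "f n x = 0" if "n \<ge> k" for n
      proof -
        have "real k * infdist x C \<le> real n * infdist x C" using that by (intro mult_right_mono infdist_nonneg) simp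
        with k show ?thesis by (simp add: f_def)
      qed
      then have "\<forall>\<^sub>F n in sequentially. f n x = 0" by (auto simp: eventually_sequentially)
      with xC show ?thesis by (simp add: tendsto_eventually)
    qed
    have bound: "norm (f n x) \<le> 1" for n x
      using mult_nonneg_nonneg[OF of_nat_0_le_iff[of n] infdist_nonneg[of x C]] by (simp add: f_def)
    have lim: "(\<lambda>n. \<integral>x. f n x \<partial>L) \<longlonglongrightarrow> measure L C" if "prob_space L" "sets L = sets borel" for L
    proof -
      interpret L: prob_space L by fact
      have "(\<lambda>n. \<integral>x. f n x \<partial>L) \<longlonglongrightarrow> (\<integral>x. indicator C x \<partial>L)"
      proof (rule integral_dominated_convergence[where w="\<lambda>_. 1"])
        show "f n \<in> borel_measurable L" for n using fm that(2) by (subst measurable_cong_sets[OF that(2) refl])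
        show "(indicator C :: _ \<Rightarrow> real) \<in> borel_measurable L"
          by (rule borel_measurable_indicator) (simp add: that(2) \<open>closed C\<close>)
      qed (use conv bound in auto)
      then show ?thesis using \<open>closed C\<close> that(2) by simp
    qed
    have "measure M C = measure N C"
      using LIMSEQ_unique[OF lim[OF M]] lim[OF N] eq[OF cont] by simp
    then show ?thesis by (simp add: M.emeasure_eq_measure N.emeasure_eq_measure)
  qed simp
  show ?thesis
  proof (rule measure_eqI_generator_eq[where E="Collect closed" and \<Omega>=UNIV and A="\<lambda>_. UNIV"])
    show "Int_stable (Collect closed)" by (auto simp: Int_stable_def)
    show "sets M = sigma_sets UNIV (Collect closed)" "sets N = sigma_sets UNIV (Collect closed)"
      using M(2) N(2) by (simp_all add: borel_eq_closed)
  qed (auto simp: closed_eq)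
qed

section \<open>Stability of optimal couplings\<close>

lemma nn_integral_cell:
  assumes [measurable]: "a \<in> measurable P (count_space UNIV)"
  shows "(\<integral>\<^sup>+x. indicator {i} (a x) \<partial>P) = emeasure P (a -` {i} \<inter> space P)"
proof -
  have "(\<integral>\<^sup>+x. indicator {i} (a x) \<partial>P) = (\<integral>\<^sup>+x. indicator (a -` {i} \<inter> space P) x \<partial>P)"
    by (intro nn_integral_cong) (simp add: indicator_def)
  also have "\<dots> = emeasure P (a -` {i} \<inter> space P)"
    using measurable_sets[OF assms, of "{i}"] by (intro nn_integral_indicator) simp
  finally show ?thesis .
qed

text \<open>There are countably many cells, so the null ones together form a null set. This
  justifies dividing by the mass of the cell of \<open>x\<close>.\<close>

lemma AE_cell_nonnull:
  fixes a :: "'x \<Rightarrow> nat"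
  assumes a: "a \<in> measurable P (count_space UNIV)"
  shows "AE x in P. emeasure P (a -` {a x} \<inter> space P) \<noteq> 0"
proof -
  have "AE x in P. a x = i \<longrightarrow> emeasure P (a -` {i} \<inter> space P) \<noteq> 0" for i
  proof (cases "emeasure P (a -` {i} \<inter> space P) = 0")
    case True
    then have "a -` {i} \<inter> space P \<in> null_sets P" using measurable_sets[OF a, of "{i}"] by auto
    then have "AE x in P. x \<notin> a -` {i} \<inter> space P" by (rule AE_not_in)
    then show ?thesis by (rule AE_mp) (auto intro!: AE_I2)
  qed simp
  then have "AE x in P. \<forall>i. a x = i \<longrightarrow> emeasure P (a -` {i} \<inter> space P) \<noteq> 0"
    by (simp only: AE_all_countable) simp
  then show ?thesis by (rule AE_mp) (auto intro!: AE_I2)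
qed

text \<open>Conditionally on the common value of \<open>a\<close> and \<open>b\<close>, the two components are taken independent.\<close>

lemma discrete_gluing:
  fixes a :: "'x \<Rightarrow> nat" and b :: "'y \<Rightarrow> nat"
  assumes P: "prob_space P" and R: "prob_space R"
    and a[measurable]: "a \<in> measurable P (count_space UNIV)"
    and b[measurable]: "b \<in> measurable R (count_space UNIV)"
    and law: "distr P (count_space UNIV) a = distr R (count_space UNIV) b"
  obtains Q where "prob_space Q" "sets Q = sets (P \<Otimes>\<^sub>M R)" "distr Q P fst = P" "distr Q R snd = R"
    "AE z in Q. a (fst z) = b (snd z)"
proof -
  interpret P: prob_space P by fact
  interpret R: prob_space R by fact
  interpret PR: pair_prob_space P R ..
  define m where "m i = emeasure P (a -` {i} \<inter> space P)" for i
  have m_R: "m i = emeasure R (b -` {i} \<inter> space R)" for i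
    using arg_cong[OF law, of "\<lambda>L. emeasure L {i}"] by (simp add: m_def emeasure_distr)
  have m_fin: "m i \<noteq> \<infinity>" for i by (simp add: m_def P.emeasure_eq_measure)
  \<comment> \<open>Density of the glued measure: on the square where \<open>a\<close> and
    \<open>b\<close> both equal \<open>i\<close>, of product mass \<open>m i\<close> squared, the
    factor 1 / \<open>m i\<close> restores the mass \<open>m i\<close>. The series form yields
    measurability. On null cells the quotient is infinite, but almost no point lies there.\<close>
  define g where "g z = (\<Sum>i. indicator {i} (a (fst z)) * indicator {i} (b (snd z)) * (1 / m i))" for z
  have g: "g z = (if a (fst z) = b (snd z) then 1 / m (a (fst z)) else 0)" for z
  proof -
    have "g z = (\<Sum>i\<in>{a (fst z)}. indicator {i} (a (fst z)) * indicator {i} (b (snd z)) * (1 / m i))"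
      unfolding g_def by (rule suminf_finite) auto
    then show ?thesis by (cases "a (fst z) = b (snd z)") simp_all
  qed
  have ind_a: "(\<lambda>x. indicator {i} (a x) :: ennreal) \<in> borel_measurable P" for i
    by (rule measurable_compose[OF a]) simp
  have ind_b: "(\<lambda>y. indicator {i} (b y) :: ennreal) \<in> borel_measurable R" for i
    by (rule measurable_compose[OF b]) simp
  have g_meas[measurable]: "g \<in> borel_measurable (P \<Otimes>\<^sub>M R)"
    unfolding g_def
    by (intro borel_measurable_suminf_order borel_measurable_times_ennreal borel_measurable_const
        measurable_compose[OF measurable_fst ind_a] measurable_compose[OF measurable_snd ind_b])
  define Q where "Q = density (P \<Otimes>\<^sub>M R) g"
  have Q_sets[measurable_cong]: "sets Q = sets (P \<Otimes>\<^sub>M R)" by (simp add: Q_def)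
  have Q_space: "space Q = space (P \<Otimes>\<^sub>M R)" by (simp add: Q_def)
  have fst_Q: "distr Q P fst = P"
  proof (rule measure_eqI)
    fix A assume "A \<in> sets (distr Q P fst)"
    then have A[measurable]: "A \<in> sets P" by simp
    have "emeasure (distr Q P fst) A = emeasure Q (fst -` A \<inter> space Q)"
      by (rule emeasure_distr) measurable
    also have "\<dots> = (\<integral>\<^sup>+z. g z * indicator (fst -` A \<inter> space (P \<Otimes>\<^sub>M R)) z \<partial>(P \<Otimes>\<^sub>M R))"
      unfolding Q_space unfolding Q_def by (rule emeasure_density) measurable
    also have "\<dots> = (\<integral>\<^sup>+z. g z * indicator A (fst z) \<partial>(P \<Otimes>\<^sub>M R))"
      by (intro nn_integral_cong) (simp add: indicator_def)
    also have "\<dots> = (\<integral>\<^sup>+x. \<integral>\<^sup>+y. g (x, y) * indicator A x \<partial>R \<partial>P)"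
      by (subst R.nn_integral_fst[symmetric]) simp_all
    also have "\<dots> = (\<integral>\<^sup>+x. indicator A x \<partial>P)"
    proof (rule nn_integral_cong_AE)
      from AE_cell_nonnull[OF a]
      show "AE x in P. (\<integral>\<^sup>+y. g (x, y) * indicator A x \<partial>R) = indicator A x"
      proof (rule AE_mp, intro AE_I2 impI)
        fix x assume x: "x \<in> space P" "emeasure P (a -` {a x} \<inter> space P) \<noteq> 0"
        have "(\<integral>\<^sup>+y. g (x, y) * indicator A x \<partial>R) =
            (\<integral>\<^sup>+y. (1 / m (a x) * indicator A x) * indicator {a x} (b y) \<partial>R)"
          by (intro nn_integral_cong) (simp add: g indicator_def)
        also have "\<dots> = (1 / m (a x) * indicator A x) * m (a x)"
          by (subst nn_integral_cmult) (simp_all add: nn_integral_cell[OF b] m_R ind_b)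
        also have "\<dots> = indicator A x"
          using x(2) m_fin[of "a x"]
          by (simp add: indicator_def ennreal_divide_times ennreal_divide_self less_top[symmetric] m_def[symmetric])
        finally show "(\<integral>\<^sup>+y. g (x, y) * indicator A x \<partial>R) = indicator A x" .
      qed
    qed
    also have "\<dots> = emeasure P A" by simp
    finally show "emeasure (distr Q P fst) A = emeasure P A" .
  qed simp
  have snd_Q: "distr Q R snd = R"
  proof (rule measure_eqI)
    fix A assume "A \<in> sets (distr Q R snd)"
    then have A[measurable]: "A \<in> sets R" by simp
    have "emeasure (distr Q R snd) A = emeasure Q (snd -` A \<inter> space Q)"
      by (rule emeasure_distr) measurable
    also have "\<dots> = (\<integral>\<^sup>+z. g z * indicator (snd -` A \<inter> space (P \<Otimes>\<^sub>M R)) z \<partial>(P \<Otimes>\<^sub>M R))"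
      unfolding Q_space unfolding Q_def by (rule emeasure_density) measurable
    also have "\<dots> = (\<integral>\<^sup>+z. g z * indicator A (snd z) \<partial>(P \<Otimes>\<^sub>M R))"
      by (intro nn_integral_cong) (simp add: indicator_def)
    also have "\<dots> = (\<integral>\<^sup>+y. \<integral>\<^sup>+x. g (x, y) * indicator A y \<partial>P \<partial>R)"
      by (subst PR.nn_integral_snd[symmetric]) simp_all
    also have "\<dots> = (\<integral>\<^sup>+y. indicator A y \<partial>R)"
    proof (rule nn_integral_cong_AE)
      from AE_cell_nonnull[OF b]
      show "AE y in R. (\<integral>\<^sup>+x. g (x, y) * indicator A y \<partial>P) = indicator A y"
      proof (rule AE_mp, intro AE_I2 impI)
        fix y assume y: "y \<in> space R" "emeasure R (b -` {b y} \<inter> space R) \<noteq> 0"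
        have "(\<integral>\<^sup>+x. g (x, y) * indicator A y \<partial>P) =
            (\<integral>\<^sup>+x. (1 / m (b y) * indicator A y) * indicator {b y} (a x) \<partial>P)"
          by (intro nn_integral_cong) (simp add: g indicator_def)
        also have "\<dots> = (1 / m (b y) * indicator A y) * m (b y)"
          by (subst nn_integral_cmult) (simp_all add: nn_integral_cell[OF a] m_def ind_a)
        also have "\<dots> = indicator A y"
          using y(2) m_fin[of "b y"]
          by (simp add: indicator_def ennreal_divide_times ennreal_divide_self less_top[symmetric] m_R[symmetric])
        finally show "(\<integral>\<^sup>+x. g (x, y) * indicator A y \<partial>P) = indicator A y" .
      qed
    qed
    also have "\<dots> = emeasure R A" by simp
    finally show "emeasure (distr Q R snd) A = emeasure R A" .
  qed simp
  have "prob_space Q"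
    by (rule prob_space_distrD[of fst Q P]) (simp_all add: fst_Q P measurable_cong_sets[OF Q_sets refl])
  moreover have "AE z in Q. a (fst z) = b (snd z)"
    unfolding Q_def by (subst AE_density) (auto simp: g)
  ultimately show ?thesis using that Q_sets fst_Q snd_Q by blast
qed

section \<open>Integrals of continuous functions under almost sure convergence, and optimality in
  the limit\<close>

lemma borel_on_real_measurable:
  fixes f :: "'e::metric_space \<Rightarrow> real"
  assumes "borel_on E M" "continuous_on E f"
  shows "(\<lambda>x. indicator E x * f x) \<in> borel_measurable M"
proof -
  have "(\<lambda>x. if x \<in> E then f x else 0) \<in> borel_measurable M"
    using assms by (intro borel_on_measurable borel_measurable_continuous_on_restrict) auto
  also have "(\<lambda>x. if x \<in> E then f x else 0) = (\<lambda>x. indicator E x * f x)" by (auto simp: fun_eq_iff)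
  finally show ?thesis .
qed

lemma indicator_mult_bound:
  fixes f :: "'e::metric_space \<Rightarrow> real"
  assumes "compact E" "continuous_on E f"
  obtains D where "\<And>x. \<bar>indicator E x * f x\<bar> \<le> D"
proof -
  have "bounded (f ` E)" using compact_continuous_image[OF assms(2,1)] by (rule compact_imp_bounded)
  then obtain D where D: "\<And>x. x \<in> E \<Longrightarrow> \<bar>f x\<bar> \<le> D" by (auto simp: bounded_iff)
  have "\<bar>indicator E x * f x\<bar> \<le> \<bar>D\<bar>" for x
  proof (cases "x \<in> E")
    case True
    then show ?thesis using D[OF True] by simp
  qed simp
  then show ?thesis by (rule that)
qed

text \<open>A continuous function on a compact set is bounded, so dominated convergence applies. The
  cut-off by the indicator of \<open>E\<close> matches the convention in \<open>weak_conv_on\<close>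
  and \<open>cost_of\<close>.\<close>

lemma integral_tendsto_continuous:
  fixes f :: "'e::metric_space \<Rightarrow> real"
  assumes P: "prob_space P" and E: "borel_on E M" and f: "continuous_on E f"
    and Z: "\<And>n. Z n \<in> measurable P M" and W: "W \<in> measurable P M"
    and ZE: "AE \<omega> in P. \<forall>n. Z n \<omega> \<in> E" and WE: "AE \<omega> in P. W \<omega> \<in> E"
    and conv: "AE \<omega> in P. (\<lambda>n. Z n \<omega>) \<longlonglongrightarrow> W \<omega>"
  shows "(\<lambda>n. \<integral>\<omega>. indicator E (Z n \<omega>) * f (Z n \<omega>) \<partial>P) \<longlonglongrightarrow> (\<integral>\<omega>. indicator E (W \<omega>) * f (W \<omega>) \<partial>P)"
proof -
  interpret prob_space P by fact
  have "compact E" using E by (simp add: borel_on_def)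
  obtain D where D: "\<And>x. \<bar>indicator E x * f x\<bar> \<le> D" using indicator_mult_bound[OF \<open>compact E\<close> f] by blast
  note meas = borel_on_real_measurable[OF E f]
  show ?thesis
  proof (rule integral_dominated_convergence[where w="\<lambda>_. D"])
    show "(\<lambda>\<omega>. indicator E (W \<omega>) * f (W \<omega>)) \<in> borel_measurable P"
      by (rule measurable_compose[OF W meas])
    show "(\<lambda>\<omega>. indicator E (Z n \<omega>) * f (Z n \<omega>)) \<in> borel_measurable P" for n
      by (rule measurable_compose[OF Z meas])
    show "AE \<omega> in P. (\<lambda>n. indicator E (Z n \<omega>) * f (Z n \<omega>)) \<longlonglongrightarrow> indicator E (W \<omega>) * f (W \<omega>)"
      using ZE WE conv
    proof eventually_elim
      case (elim \<omega>)
      then have "(\<lambda>n. f (Z n \<omega>)) \<longlonglongrightarrow> f (W \<omega>)"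
        by (intro continuous_on_tendsto_compose[OF f]) auto
      with elim show ?case by simp
    qed
  qed (use D in auto)
qed

lemma cost_of_distr:
  fixes X :: "'a::metric_space set" and Y :: "'b::metric_space set"
  assumes X: "compact X" and Y: "compact Y" and c: "continuous_on (X \<times> Y) (\<lambda>(x, y). c x y)"
    and f: "f \<in> measurable P (borel \<Otimes>\<^sub>M borel)"
  shows "cost_of X Y c (distr P (borel \<Otimes>\<^sub>M borel) f) =
    (\<integral>z. indicator (X \<times> Y) (f z) * (case f z of (x, y) \<Rightarrow> c x y) \<partial>P)"
proof -
  have "(\<lambda>p. indicator (X \<times> Y) p * (\<lambda>(x, y). c x y) p) \<in> borel_measurable (borel \<Otimes>\<^sub>M borel)"
    by (intro borel_on_real_measurable borel_on_pair borel_on_borel X Y c)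
  from integral_distr[OF f this] show ?thesis by (simp add: cost_of_def case_prod_unfold)
qed

text \<open>To compare with a competitor \<open>\<pi>\<close> for the limit problem, glue \<open>\<pi>\<close> to \<open>P\<close> so that its first
  component and \<open>W\<close> lie in the same small cell of \<open>X\<close>. Replacing the first component by \<open>Z n\<close> then
  gives competitors for the approximating problems whose costs converge, and the limit
  exceeds the cost of \<open>\<pi>\<close> by at most \<open>\<epsilon>\<close>.\<close>

lemma opt_couplings_limit:
  fixes X :: "'a::metric_space set" and Y :: "'b::metric_space set"
  assumes X: "compact X" and Y: "compact Y" and c: "continuous_on (X \<times> Y) (\<lambda>(x, y). c x y)"
    and P: "prob_space P"
    and Z: "\<And>n. Z n \<in> borel_measurable P" "\<And>n. AE \<omega> in P. Z n \<omega> \<in> X"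
    and W: "W \<in> borel_measurable P" "AE \<omega> in P. W \<omega> \<in> X" "AE \<omega> in P. (\<lambda>n. Z n \<omega>) \<longlonglongrightarrow> W \<omega>"
    and U: "\<And>n. U n \<in> borel_measurable P" "\<And>n. AE \<omega> in P. U n \<omega> \<in> Y"
    and V: "V \<in> borel_measurable P" "AE \<omega> in P. V \<omega> \<in> Y" "AE \<omega> in P. (\<lambda>n. U n \<omega>) \<longlonglongrightarrow> V \<omega>"
    and opt: "\<And>n. distr P (borel \<Otimes>\<^sub>M borel) (\<lambda>\<omega>. (Z n \<omega>, U n \<omega>)) \<in> opt_couplings X Y c (\<mu>n n) \<nu>"
    and \<mu>: "distr P borel W = \<mu>" and \<nu>: "distr P borel V = \<nu>"
  shows "distr P (borel \<Otimes>\<^sub>M borel) (\<lambda>\<omega>. (W \<omega>, V \<omega>)) \<in> opt_couplings X Y c \<mu> \<nu>"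
proof -
  interpret P: prob_space P by fact
  let ?BB = "borel \<Otimes>\<^sub>M borel :: ('a \<times> 'b) measure"
  let ?E = "X \<times> Y"
  define f where "f p = (case p of (x, y) \<Rightarrow> c x y)" for p
  define F where "F p = indicator ?E p * f p" for p
  have E: "borel_on ?E ?BB" by (intro borel_on_pair borel_on_borel X Y)
  have "compact ?E" by (intro compact_Times X Y)
  have f: "continuous_on ?E f" unfolding f_def using c by simp
  have F_meas: "F \<in> borel_measurable ?BB" unfolding F_def by (rule borel_on_real_measurable[OF E f])
  obtain D where D: "\<And>x. \<bar>F x\<bar> \<le> D" unfolding F_def using indicator_mult_bound[OF \<open>compact ?E\<close> f] by blast
  note [measurable] = Z(1) W(1) U(1) V(1)
  have ZU: "(\<lambda>\<omega>. (Z n \<omega>, U n \<omega>)) \<in> measurable P ?BB" for n by measurable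
  have WV: "(\<lambda>\<omega>. (W \<omega>, V \<omega>)) \<in> measurable P ?BB" by measurable
  have coup: "distr P ?BB (\<lambda>\<omega>. (W \<omega>, V \<omega>)) \<in> couplings \<mu> \<nu>"
    unfolding couplings_def
  proof (intro CollectI conjI)
    show "prob_space (distr P ?BB (\<lambda>\<omega>. (W \<omega>, V \<omega>)))" by (rule P.prob_space_distr[OF WV])
    show "distr (distr P ?BB (\<lambda>\<omega>. (W \<omega>, V \<omega>))) borel fst = \<mu>"
      by (subst distr_distr[OF _ WV]) (auto simp: comp_def \<mu>)
    show "distr (distr P ?BB (\<lambda>\<omega>. (W \<omega>, V \<omega>))) borel snd = \<nu>"
      by (subst distr_distr[OF _ WV]) (auto simp: comp_def \<nu>)
  qed simp
  have ZX: "AE \<omega> in P. \<forall>n. Z n \<omega> \<in> X" using Z(2) by (simp add: AE_all_countable)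
  have UY: "AE \<omega> in P. \<forall>n. U n \<omega> \<in> Y" using U(2) by (simp add: AE_all_countable)
  have lim1: "(\<lambda>n. cost_of X Y c (distr P ?BB (\<lambda>\<omega>. (Z n \<omega>, U n \<omega>)))) \<longlonglongrightarrow>
      cost_of X Y c (distr P ?BB (\<lambda>\<omega>. (W \<omega>, V \<omega>)))"
    unfolding cost_of_distr[OF X Y c ZU] cost_of_distr[OF X Y c WV] f_def[symmetric]
  proof (rule integral_tendsto_continuous[OF P E f ZU WV])
    show "AE \<omega> in P. \<forall>n. (Z n \<omega>, U n \<omega>) \<in> X \<times> Y" using ZX UY by eventually_elim simp
    show "AE \<omega> in P. (W \<omega>, V \<omega>) \<in> X \<times> Y" using W(2) V(2) by eventually_elim simp
    show "AE \<omega> in P. (\<lambda>n. (Z n \<omega>, U n \<omega>)) \<longlonglongrightarrow> (W \<omega>, V \<omega>)"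
      using W(3) V(3) by eventually_elim (rule tendsto_Pair)
  qed
  have "cost_of X Y c (distr P ?BB (\<lambda>\<omega>. (W \<omega>, V \<omega>))) \<le> cost_of X Y c \<pi>"
    if \<pi>: "\<pi> \<in> couplings \<mu> \<nu>" for \<pi>
  proof (rule field_le_epsilon)
    fix \<epsilon> :: real assume "\<epsilon> > 0"
    have \<pi>': "prob_space \<pi>" "sets \<pi> = sets ?BB" "distr \<pi> borel fst = \<mu>" "distr \<pi> borel snd = \<nu>"
      using \<pi> by (auto simp: couplings_def)
    note [measurable_cong] = \<pi>'(2)
    have "uniformly_continuous_on ?E f" by (rule compact_uniformly_continuous[OF f \<open>compact ?E\<close>])
    then obtain \<delta> where \<delta>: "\<delta> > 0" "\<And>p q. p \<in> ?E \<Longrightarrow> q \<in> ?E \<Longrightarrow> dist q p < \<delta> \<Longrightarrow> dist (f q) (f p) < \<epsilon>"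
      using \<open>\<epsilon> > 0\<close> unfolding uniformly_continuous_on_def by blast
    obtain a :: "'a \<Rightarrow> nat" where a: "a \<in> measurable borel (count_space UNIV)"
        "\<And>x y. x \<in> X \<Longrightarrow> y \<in> X \<Longrightarrow> a x = a y \<Longrightarrow> dist x y < \<delta>"
      by (rule compact_fine_cells[OF X \<delta>(1)]) blast
    have aW: "(\<lambda>\<omega>. a (W \<omega>)) \<in> measurable P (count_space UNIV)" by (rule measurable_compose[OF W(1) a(1)])
    have fst_m: "fst \<in> measurable \<pi> borel" and snd_m: "snd \<in> measurable \<pi> borel" by measurable
    have afst: "(\<lambda>p. a (fst p)) \<in> measurable \<pi> (count_space UNIV)" by (rule measurable_compose[OF fst_m a(1)])
    have "distr P (count_space UNIV) (\<lambda>\<omega>. a (W \<omega>)) = distr (distr P borel W) (count_space UNIV) a"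
      by (simp add: distr_distr[OF a(1) W(1)] comp_def)
    also have "\<dots> = distr \<pi> (count_space UNIV) (\<lambda>p. a (fst p))"
      by (simp add: \<mu> \<pi>'(3)[symmetric] distr_distr[OF a(1) fst_m] comp_def)
    finally obtain Q where Q: "prob_space Q" "sets Q = sets (P \<Otimes>\<^sub>M \<pi>)" "distr Q P fst = P" "distr Q \<pi> snd = \<pi>"
        "AE z in Q. a (W (fst z)) = a (fst (snd z))"
      by (rule discrete_gluing[OF P \<pi>'(1) aW afst])
    interpret Q: prob_space Q by fact
    note [measurable_cong] = Q(2)
    have Qf: "fst \<in> measurable Q P" and Qs: "snd \<in> measurable Q \<pi>" by measurable
    have Qs': "snd \<in> measurable Q ?BB" by measurable
    have QZ: "(\<lambda>z. (Z n (fst z), snd (snd z))) \<in> measurable Q ?BB" for n by measurable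
    have QW: "(\<lambda>z. (W (fst z), snd (snd z))) \<in> measurable Q ?BB" by measurable
    have AE_P: "AE z in Q. R (fst z)" if "AE \<omega> in P. R \<omega>" for R
      by (rule AE_distrD[OF Qf]) (subst Q(3), rule that)
    have AE_\<pi>: "AE z in Q. R (snd z)" if "AE p in \<pi>. R p" for R
      by (rule AE_distrD[OF Qs]) (subst Q(4), rule that)
    \<comment> \<open>A competitor is given only through its marginals. That it is carried by
      \<open>X \<times> Y\<close> is inherited from \<mu> and \<nu>, which are the laws of
      \<open>W\<close> and \<open>V\<close>.\<close>
    have "AE y in \<nu>. y \<in> Y"
      unfolding \<nu>[symmetric] using V(2) Y
      by (subst AE_distr_iff[OF V(1)]) (auto intro: borel_compact)
    then have \<pi>Y: "AE p in \<pi>. snd p \<in> Y"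
      by (intro AE_distrD[OF snd_m]) (subst \<pi>'(4))
    have "AE x in \<mu>. x \<in> X"
      unfolding \<mu>[symmetric] using W(2) X
      by (subst AE_distr_iff[OF W(1)]) (auto intro: borel_compact)
    then have \<pi>X: "AE p in \<pi>. fst p \<in> X"
      by (intro AE_distrD[OF fst_m]) (subst \<pi>'(3))
    have lim2: "(\<lambda>n. cost_of X Y c (distr Q ?BB (\<lambda>z. (Z n (fst z), snd (snd z))))) \<longlonglongrightarrow>
        cost_of X Y c (distr Q ?BB (\<lambda>z. (W (fst z), snd (snd z))))"
      unfolding cost_of_distr[OF X Y c QZ] cost_of_distr[OF X Y c QW] f_def[symmetric]
    proof (rule integral_tendsto_continuous[OF Q(1) E f QZ QW])
      show "AE z in Q. \<forall>n. (Z n (fst z), snd (snd z)) \<in> X \<times> Y"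
        using AE_P[OF ZX] AE_\<pi>[OF \<pi>Y] by eventually_elim simp
      show "AE z in Q. (W (fst z), snd (snd z)) \<in> X \<times> Y"
        using AE_P[OF W(2)] AE_\<pi>[OF \<pi>Y] by eventually_elim simp
      show "AE z in Q. (\<lambda>n. (Z n (fst z), snd (snd z))) \<longlonglongrightarrow> (W (fst z), snd (snd z))"
        using AE_P[OF W(3)] by eventually_elim (intro tendsto_Pair tendsto_const)
    qed
    \<comment> \<open>The modified coupling takes its first component from \<open>Z n\<close> and
      its second from \<pi>, so it has marginals \<open>\<mu>n n\<close> and \<nu> and optimality of
      the given coupling applies.\<close>
    have le: "cost_of X Y c (distr P ?BB (\<lambda>\<omega>. (Z n \<omega>, U n \<omega>))) \<le>
        cost_of X Y c (distr Q ?BB (\<lambda>z. (Z n (fst z), snd (snd z))))" for n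
    proof -
      have c1: "distr P ?BB (\<lambda>\<omega>. (Z n \<omega>, U n \<omega>)) \<in> couplings (\<mu>n n) \<nu>"
        using opt[of n] by (simp add: opt_couplings_def)
      then have "distr (distr P ?BB (\<lambda>\<omega>. (Z n \<omega>, U n \<omega>))) borel fst = \<mu>n n" by (simp add: couplings_def)
      then have \<mu>n: "distr P borel (Z n) = \<mu>n n"
        by (subst (asm) distr_distr[OF _ ZU]) (simp_all add: comp_def)
      have "distr Q ?BB (\<lambda>z. (Z n (fst z), snd (snd z))) \<in> couplings (\<mu>n n) \<nu>"
        unfolding couplings_def
      proof (intro CollectI conjI)
        show "prob_space (distr Q ?BB (\<lambda>z. (Z n (fst z), snd (snd z))))" by (rule Q.prob_space_distr[OF QZ])
        have "distr (distr Q ?BB (\<lambda>z. (Z n (fst z), snd (snd z)))) borel fst = distr Q borel (\<lambda>z. Z n (fst z))"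
          by (subst distr_distr[OF _ QZ]) (simp_all add: comp_def)
        also have "\<dots> = distr (distr Q P fst) borel (Z n)"
          by (subst distr_distr[OF Z(1) Qf]) (simp add: comp_def)
        finally show "distr (distr Q ?BB (\<lambda>z. (Z n (fst z), snd (snd z)))) borel fst = \<mu>n n"
          by (simp add: Q(3) \<mu>n)
        have "distr (distr Q ?BB (\<lambda>z. (Z n (fst z), snd (snd z)))) borel snd = distr Q borel (\<lambda>z. snd (snd z))"
          by (subst distr_distr[OF _ QZ]) (simp_all add: comp_def)
        also have "\<dots> = distr (distr Q \<pi> snd) borel snd"
          by (subst distr_distr[OF snd_m Qs]) (simp add: comp_def)
        finally show "distr (distr Q ?BB (\<lambda>z. (Z n (fst z), snd (snd z)))) borel snd = \<nu>"
          by (simp add: Q(4) \<pi>'(4))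
      qed simp
      then show ?thesis using opt[of n] by (simp add: opt_couplings_def)
    qed
    have F_int: "integrable Q (\<lambda>z. F (g z))" if "g \<in> measurable Q ?BB" for g
      by (rule Q.integrable_const_bound[where B=D]) (use D measurable_compose[OF that F_meas] in auto)
    have "cost_of X Y c (distr P ?BB (\<lambda>\<omega>. (W \<omega>, V \<omega>))) \<le> cost_of X Y c (distr Q ?BB (\<lambda>z. (W (fst z), snd (snd z))))"
      by (rule LIMSEQ_le[OF lim1 lim2]) (use le in blast)
    also have "\<dots> = (\<integral>z. F (W (fst z), snd (snd z)) \<partial>Q)"
      unfolding cost_of_distr[OF X Y c QW] by (simp add: F_def f_def)
    also have "\<dots> \<le> (\<integral>z. F (snd z) + \<epsilon> \<partial>Q)"
    proof (rule integral_mono_AE)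
      show "integrable Q (\<lambda>z. F (W (fst z), snd (snd z)))" by (rule F_int[OF QW])
      show "integrable Q (\<lambda>z. F (snd z) + \<epsilon>)" by (intro Bochner_Integration.integrable_add F_int[OF Qs']) simp
      show "AE z in Q. F (W (fst z), snd (snd z)) \<le> F (snd z) + \<epsilon>"
        using Q(5) AE_P[OF W(2)] AE_\<pi>[OF \<pi>X] AE_\<pi>[OF \<pi>Y]
      proof eventually_elim
        case (elim z)
        let ?p = "(W (fst z), snd (snd z))"
        have pE: "?p \<in> ?E" "snd z \<in> ?E" using elim by (auto simp: mem_Times_iff)
        \<comment> \<open>The two points share their second component, so their distance is the one
          in \<open>X\<close> between two points of the same cell.\<close>
        have "dist ?p (snd z) < \<delta>"
          using a(2)[OF elim(2,3,1)] by (simp add: dist_prod_def)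
        from \<delta>(2)[OF pE(2,1) this] have "f ?p < f (snd z) + \<epsilon>" by (simp add: dist_real_def)
        with pE show ?case by (simp add: F_def)
      qed
    qed
    also have "\<dots> = (\<integral>z. F (snd z) \<partial>Q) + \<epsilon>"
      by (subst Bochner_Integration.integral_add) (simp_all add: F_int[OF Qs'] Q.prob_space)
    also have "(\<integral>z. F (snd z) \<partial>Q) = (\<integral>p. F p \<partial>distr Q \<pi> snd)"
      using F_meas by (subst integral_distr[OF Qs]) (simp_all add: measurable_cong_sets[OF \<pi>'(2) refl])
    also have "\<dots> = cost_of X Y c \<pi>"
      by (simp add: Q(4) cost_of_def F_def f_def case_prod_unfold)
    finally show "cost_of X Y c (distr P ?BB (\<lambda>\<omega>. (W \<omega>, V \<omega>))) \<le> cost_of X Y c \<pi> + \<epsilon>" .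
  qed
  with coup show ?thesis by (simp add: opt_couplings_def)
qed

lemma integrable_continuous_compact:
  fixes f :: "'e::metric_space \<Rightarrow> real"
  assumes P: "prob_space P" and E: "borel_on E M" and f: "continuous_on E f" and g: "g \<in> measurable P M"
  shows "integrable P (\<lambda>\<omega>. indicator E (g \<omega>) * f (g \<omega>))"
proof -
  interpret prob_space P by fact
  have "compact E" using E by (simp add: borel_on_def)
  from this f show ?thesis
  proof (rule indicator_mult_bound)
    fix D assume D: "\<bar>indicator E x * f x\<bar> \<le> D" for x
    show ?thesis
    proof (rule integrable_const_bound)
      show "AE \<omega> in P. norm (indicator E (g \<omega>) * f (g \<omega>)) \<le> D"
        by (rule AE_I2) (simp only: real_norm_def D)
    qed (rule measurable_compose[OF g borel_on_real_measurable[OF E f]])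
  qed
qed

text \<open>If \<open>B\<close> jumped at \<open>v\<close>, compactness would give a cluster point
  of the values \<open>B w\<close>, with \<open>w\<close> tending to \<open>v\<close>, away from
  \<open>B v\<close>. By continuity of \<open>S\<close> it would also minimise at \<open>v\<close>,
  against uniqueness.\<close>

lemma continuous_on_argmin:
  fixes S :: "'a::metric_space \<Rightarrow> 'v::metric_space \<Rightarrow> real"
  assumes X: "compact X" and S: "continuous_on (X \<times> V) (\<lambda>(x, v). S x v)"
    and B: "\<And>v. v \<in> V \<Longrightarrow> B v \<in> X" "\<And>v x. v \<in> V \<Longrightarrow> x \<in> X \<Longrightarrow> x \<noteq> B v \<Longrightarrow> S (B v) v < S x v"
  shows "continuous_on V B"
proof (rule ccontr)
  assume "\<not> continuous_on V B"
  then obtain v \<epsilon> where v: "v \<in> V" "\<epsilon> > 0"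
      and far: "\<And>\<delta>. \<delta> > 0 \<Longrightarrow> \<exists>w\<in>V. dist w v < \<delta> \<and> \<not> dist (B w) (B v) < \<epsilon>"
    unfolding continuous_on_iff by blast
  have "\<forall>n. \<exists>w. w \<in> V \<and> dist w v < 1 / Suc n \<and> \<not> dist (B w) (B v) < \<epsilon>"
    using far[of "1 / Suc n" for n] by (simp add: Bex_def)
  from choice[OF this] obtain w
    where w: "\<forall>n. w n \<in> V \<and> dist (w n) v < 1 / Suc n \<and> \<not> dist (B (w n)) (B v) < \<epsilon>" ..
  have wV: "w n \<in> V" and wd: "dist (w n) v < 1 / Suc n" and wB: "dist (B (w n)) (B v) \<ge> \<epsilon>" for n
    using w by (simp_all add: not_less)
  have "w \<longlonglongrightarrow> v"
  proof (rule metric_tendsto_imp_tendsto[OF LIMSEQ_inverse_real_of_nat])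
    have "dist (w n) v \<le> dist (inverse (real (Suc n))) 0" for n
      using wd[of n] by (simp add: inverse_eq_divide)
    then show "\<forall>\<^sub>F n in sequentially. dist (w n) v \<le> dist (inverse (real (Suc n))) 0" by simp
  qed
  have BX: "\<forall>n. B (w n) \<in> X" using B(1) wV by simp
  obtain x r where x: "x \<in> X" "strict_mono (r :: nat \<Rightarrow> nat)" "((\<lambda>n. B (w n)) \<circ> r) \<longlonglongrightarrow> x"
    using X[unfolded compact_def, rule_format, of "\<lambda>n. B (w n)"] BX by blast
  have lim_B: "(\<lambda>n. B (w (r n))) \<longlonglongrightarrow> x" using x(3) by (simp add: comp_def)
  have lim_w: "(\<lambda>n. w (r n)) \<longlonglongrightarrow> v" using LIMSEQ_subseq_LIMSEQ[OF \<open>w \<longlonglongrightarrow> v\<close> x(2)] by (simp add: comp_def)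
  have "\<epsilon> \<le> dist x (B v)"
    by (rule LIMSEQ_le_const[OF tendsto_dist[OF lim_B tendsto_const]]) (use wB in auto)
  then have "x \<noteq> B v" using v(2) by auto
  have "(\<lambda>n. case (B (w (r n)), w (r n)) of (x, v) \<Rightarrow> S x v) \<longlonglongrightarrow> (case (x, v) of (x, v) \<Rightarrow> S x v)"
    by (rule continuous_on_tendsto_compose[OF S tendsto_Pair[OF lim_B lim_w]])
       (use x(1) v(1) wV BX in auto)
  moreover have "(\<lambda>n. case (B v, w (r n)) of (x, v) \<Rightarrow> S x v) \<longlonglongrightarrow> (case (B v, v) of (x, v) \<Rightarrow> S x v)"
    by (rule continuous_on_tendsto_compose[OF S tendsto_Pair[OF tendsto_const lim_w]])
       (use B(1) v(1) wV in auto)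
  ultimately have "(case (x, v) of (x, v) \<Rightarrow> S x v) \<le> (case (B v, v) of (x, v) \<Rightarrow> S x v)"
  proof (rule LIMSEQ_le)
    have "S (B (w n)) (w n) \<le> S (B v) (w n)" for n
      using B(2)[OF wV, of "B v" n] B(1)[OF v(1)] by (cases "B v = B (w n)") auto
    then show "\<exists>N. \<forall>n\<ge>N. (case (B (w (r n)), w (r n)) of (x, v) \<Rightarrow> S x v) \<le> (case (B v, w (r n)) of (x, v) \<Rightarrow> S x v)"
      by simp
  qed
  with B(2)[OF v(1) x(1) \<open>x \<noteq> B v\<close>] show False by simp
qed

section \<open>Probability measures carried by a compact set: identification and existence of weak
  limits\<close>

lemma Prob_onD:
  assumes "Prob_on X \<mu>" "compact X"
  shows "prob_space \<mu>" "sets \<mu> = sets borel" "AE x in \<mu>. x \<in> X"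
proof -
  show \<mu>: "prob_space \<mu>" "sets \<mu> = sets borel" using assms by (auto simp: Prob_on_def)
  interpret prob_space \<mu> by fact
  have "emeasure \<mu> X = 1" using assms by (simp add: Prob_on_def)
  then have "prob X = 1" by (simp add: emeasure_eq_measure)
  then show "AE x in \<mu>. x \<in> X" by (rule AE_prob_1)
qed

lemma Prob_onI:
  assumes "prob_space \<mu>" "sets \<mu> = sets borel" "AE x in \<mu>. x \<in> X" "compact X"
  shows "Prob_on X \<mu>"
proof -
  interpret prob_space \<mu> by fact
  have "X \<in> sets \<mu>" using assms by (simp add: borel_compact)
  with assms(3) have "prob X = 1" by (simp add: AE_in_set_eq_1)
  with assms show ?thesis by (simp add: Prob_on_def emeasure_eq_measure)
qed

text \<open>The same integrals converge to the integral of the almost sure limit and to that of the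
  prescribed weak limit. Continuous test functions then identify the two laws.\<close>

lemma distr_limit_eqI:
  fixes X :: "'a::metric_space set"
  assumes X: "compact X" and P: "prob_space P" and \<mu>: "Prob_on X \<mu>"
    and Z: "\<And>n. Z n \<in> borel_measurable P" "\<And>n \<omega>. Z n \<omega> \<in> X"
    and W: "W \<in> borel_measurable P" "\<And>\<omega>. W \<omega> \<in> X" "AE \<omega> in P. (\<lambda>n. Z n \<omega>) \<longlonglongrightarrow> W \<omega>"
    and lim: "weak_conv_on X (\<lambda>n. distr P borel (Z n)) \<mu>"
  shows "distr P borel W = \<mu>"
proof (rule prob_eqI_continuous_integrals)
  interpret prob_space P by fact
  show "prob_space (distr P borel W)" by (rule prob_space_distr[OF W(1)])
  note \<mu>D = Prob_onD[OF \<mu> X]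
  show "prob_space \<mu>" "sets \<mu> = sets borel" by (rule \<mu>D)+
  fix f :: "'a \<Rightarrow> real" assume f: "continuous_on UNIV f"
  then have f': "f \<in> borel_measurable borel" by (rule borel_measurable_continuous_onI)
  have fX: "continuous_on X f" using f by (rule continuous_on_subset) simp
  have g: "(\<lambda>x. indicator X x * f x) \<in> borel_measurable borel"
    by (rule borel_on_real_measurable[OF borel_on_borel[OF X] fX])
  have "(\<lambda>n. \<integral>\<omega>. indicator X (Z n \<omega>) * f (Z n \<omega>) \<partial>P) \<longlonglongrightarrow> (\<integral>\<omega>. indicator X (W \<omega>) * f (W \<omega>) \<partial>P)"
    by (rule integral_tendsto_continuous[OF P borel_on_borel[OF X] fX Z(1) W(1)]) (use Z W in auto)
  moreover have "(\<lambda>n. \<integral>\<omega>. indicator X (Z n \<omega>) * f (Z n \<omega>) \<partial>P) \<longlonglongrightarrow> (\<integral>x. indicator X x * f x \<partial>\<mu>)"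
    using lim[unfolded weak_conv_on_def, rule_format, OF fX] by (simp only: integral_distr[OF Z(1) g])
  ultimately have "(\<integral>\<omega>. indicator X (W \<omega>) * f (W \<omega>) \<partial>P) = (\<integral>x. indicator X x * f x \<partial>\<mu>)"
    by (rule LIMSEQ_unique)
  also have "(\<integral>x. indicator X x * f x \<partial>\<mu>) = (\<integral>x. f x \<partial>\<mu>)"
  proof (rule integral_cong_AE)
    show "(\<lambda>x. indicator X x * f x) \<in> borel_measurable \<mu>" "f \<in> borel_measurable \<mu>"
      by (subst measurable_cong_sets[OF \<mu>D(2) refl], rule g f')+
    show "AE x in \<mu>. indicator X x * f x = f x" using \<mu>D(3) by eventually_elim simp
  qed
  also have "(\<integral>\<omega>. indicator X (W \<omega>) * f (W \<omega>) \<partial>P) = (\<integral>x. f x \<partial>distr P borel W)"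
    using W(2) by (simp add: integral_distr[OF W(1) f'])
  finally show "(\<integral>x. f x \<partial>distr P borel W) = (\<integral>x. f x \<partial>\<mu>)" .
qed simp

text \<open>Almost sure convergence implies weak convergence of the laws, so the law of the almost
  sure limit is the required measure.\<close>

lemma weak_subsequence_exists:
  fixes X :: "'a::metric_space set" and \<mu>s :: "nat \<Rightarrow> 'a measure"
  assumes X: "compact X" and \<mu>s: "\<And>n. Prob_on X (\<mu>s n)"
  shows "\<exists>r \<mu>. strict_mono r \<and> Prob_on X \<mu> \<and> weak_conv_on X (\<mu>s \<circ> r) \<mu>"
proof -
  note \<mu>D = Prob_onD[OF \<mu>s X]
  obtain \<Omega> :: "real measure" and r Z W where \<Omega>: "prob_space \<Omega>" and r: "strict_mono r"
    and Z: "\<And>n. Z n \<in> borel_measurable \<Omega>" "\<And>n. distr \<Omega> borel (Z n) = \<mu>s (r n)" "\<And>n \<omega>. Z n \<omega> \<in> X"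
    and W: "W \<in> borel_measurable \<Omega>" "\<And>\<omega>. W \<omega> \<in> X" "AE \<omega> in \<Omega>. (\<lambda>n. Z n \<omega>) \<longlonglongrightarrow> W \<omega>"
    using skorohod_compact[OF borel_on_borel[OF X], of \<mu>s, OF \<mu>D] by blast
  interpret prob_space \<Omega> by fact
  have "Prob_on X (distr \<Omega> borel W)"
  proof (rule Prob_onI)
    show "prob_space (distr \<Omega> borel W)" by (rule prob_space_distr[OF W(1)])
    show "AE x in distr \<Omega> borel W. x \<in> X"
      using W(2) X by (subst AE_distr_iff[OF W(1)]) (auto intro: borel_compact)
  qed (use X in auto)
  moreover have "weak_conv_on X (\<mu>s \<circ> r) (distr \<Omega> borel W)"
    unfolding weak_conv_on_def
  proof (intro allI impI)
    fix f :: "'a \<Rightarrow> real" assume f: "continuous_on X f"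
    have g: "(\<lambda>x. indicator X x * f x) \<in> borel_measurable borel"
      by (rule borel_on_real_measurable[OF borel_on_borel[OF X] f])
    have "(\<lambda>n. \<integral>\<omega>. indicator X (Z n \<omega>) * f (Z n \<omega>) \<partial>\<Omega>) \<longlonglongrightarrow> (\<integral>\<omega>. indicator X (W \<omega>) * f (W \<omega>) \<partial>\<Omega>)"
      by (rule integral_tendsto_continuous[OF \<Omega> borel_on_borel[OF X] f Z(1) W(1)]) (use Z W in auto)
    then show "(\<lambda>n. \<integral>x. indicator X x * f x \<partial>(\<mu>s \<circ> r) n) \<longlonglongrightarrow> (\<integral>x. indicator X x * f x \<partial>distr \<Omega> borel W)"
      by (simp add: comp_def Z(2)[symmetric] integral_distr[OF Z(1) g] integral_distr[OF W(1) g])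
  qed
  ultimately show ?thesis using r by blast
qed

section \<open>The barycentre iteration\<close>

text \<open>Nontriviality is present through two consequences: a point of \<open>X\<close> as
  default value of the barycentre map, and \<open>K > 0\<close>, which ties the first marginal of a
  plan to the given measure.\<close>

locale barycentre_problem =
  fixes K :: nat
    and X :: "'a::metric_space set"
    and Y :: "nat \<Rightarrow> 'b::metric_space set"
    and c :: "nat \<Rightarrow> 'a \<Rightarrow> 'b \<Rightarrow> real"
    and B :: "(nat \<Rightarrow> 'b) \<Rightarrow> 'a"
    and \<nu> :: "nat \<Rightarrow> 'b measure"
  assumes X_compact: "compact X" and X_nonempty: "X \<noteq> {}"
    and Y_compact: "\<And>k. k < K \<Longrightarrow> compact (Y k)"
    and c_cont: "\<And>k. k < K \<Longrightarrow> continuous_on (X \<times> Y k) (\<lambda>(x, y). c k x y)"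
    and c_nonneg: "\<And>k x y. k < K \<Longrightarrow> x \<in> X \<Longrightarrow> y \<in> Y k \<Longrightarrow> c k x y \<ge> 0"
    and B_in: "\<And>v. v \<in> PiE {..<K} Y \<Longrightarrow> B v \<in> X"
    and B_min: "\<And>v x. v \<in> PiE {..<K} Y \<Longrightarrow> x \<in> X \<Longrightarrow> x \<noteq> B v \<Longrightarrow>
      (\<Sum>k<K. c k (B v) (v k)) < (\<Sum>k<K. c k x (v k))"
    and \<nu>_prob: "\<And>k. k < K \<Longrightarrow> Prob_on (Y k) (\<nu> k)"
    and K_pos: "K > 0"
begin

abbreviation "V \<equiv> PiE {..<K} Y"
abbreviation "M \<equiv> (borel :: 'a measure) \<Otimes>\<^sub>M (Ymeas K :: (nat \<Rightarrow> 'b) measure)"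
abbreviation "BB \<equiv> (borel :: 'a measure) \<Otimes>\<^sub>M (borel :: 'b measure)"
abbreviation "\<Gamma> \<equiv> Gamma_set K X Y c \<nu>"

definition "S p = (\<Sum>k<K. c k (fst p) (snd p k))"
text \<open>The minimum of the total cost over x for fixed Y. It is written as a function of the
  pair so that it is integrated against the same plan as \<open>S\<close>.\<close>

definition "T p = S (B (snd p), snd p)"
definition "cost \<gamma> = (\<integral>p. indicator (X \<times> V) p * S p \<partial>\<gamma>)"
definition "min_cost \<gamma> = (\<integral>p. indicator (X \<times> V) p * T p \<partial>\<gamma>)"
text \<open>With this map, \<open>G_set\<close> at \<mu> is the image of \<Gamma>(\<mu>).\<close>

definition "bary \<gamma> = distr (distr \<gamma> (Ymeas K) snd) borel (Bext K X Y B)"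

section \<open>Continuity and measurability of the total cost and of the barycentre map\<close>

lemma borel_on_V: "borel_on V (Ymeas K)"
  unfolding Ymeas_def by (intro borel_on_PiE Y_compact) auto

lemma borel_on_XV: "borel_on (X \<times> V) M"
  by (intro borel_on_pair borel_on_V borel_on_borel X_compact)

lemma compact_XV: "compact (X \<times> V)"
  using borel_on_XV by (simp add: borel_on_def)

lemma proj_meas: "k < K \<Longrightarrow> (\<lambda>v. v k) \<in> measurable (Ymeas K) borel"
  unfolding Ymeas_def by (rule measurable_component_singleton) simp

lemma pair_proj_meas: "k < K \<Longrightarrow> (\<lambda>p. (fst p, snd p k)) \<in> measurable M BB"
  by (intro measurable_Pair measurable_fst measurable_compose[OF measurable_snd proj_meas])

lemma proj_cont: "continuous_on A (\<lambda>p::'a \<times> (nat \<Rightarrow> 'b). (fst p, snd p k))"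
  by (intro continuous_on_Pair continuous_on_fst continuous_on_id
      continuous_on_product_then_coordinatewise[OF continuous_on_snd[OF continuous_on_id]])

lemma c_cont_XV:
  assumes "k < K"
  shows "continuous_on (X \<times> V) (\<lambda>p. c k (fst p) (snd p k))"
proof -
  have "(\<lambda>p. (fst p, snd p k)) ` (X \<times> V) \<subseteq> X \<times> Y k"
    using assms by (intro image_subsetI) (simp add: mem_Times_iff PiE_iff)
  from continuous_on_compose2[OF c_cont[OF assms] proj_cont this] show ?thesis by simp
qed

lemma S_cont: "continuous_on (X \<times> V) S"
  unfolding S_def by (intro continuous_on_sum c_cont_XV) simp

lemma B_cont: "continuous_on V B"
proof (rule continuous_on_argmin[OF X_compact])
  show "continuous_on (X \<times> V) (\<lambda>(x, v). S (x, v))" using S_cont by simp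
  show "S (B v, v) < S (x, v)" if "v \<in> V" "x \<in> X" "x \<noteq> B v" for v x
    using B_min[OF that] by (simp add: S_def)
qed (rule B_in)

lemma T_cont: "continuous_on (X \<times> V) T"
proof -
  have "snd ` (X \<times> V) \<subseteq> V" by (intro image_subsetI) (simp add: mem_Times_iff)
  from continuous_on_compose2[OF B_cont continuous_on_snd[OF continuous_on_id] this]
  have "continuous_on (X \<times> V) (\<lambda>p. B (snd p))" .
  then have "continuous_on (X \<times> V) (\<lambda>p. (B (snd p), snd p))"
    by (intro continuous_on_Pair continuous_on_snd continuous_on_id)
  moreover have "(\<lambda>p. (B (snd p), snd p)) ` (X \<times> V) \<subseteq> X \<times> V"
    by (intro image_subsetI) (simp add: mem_Times_iff B_in)
  ultimately show ?thesis
    unfolding T_def by (rule continuous_on_compose2[OF S_cont])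
qed

lemma T_less_S:
  assumes "p \<in> X \<times> V" "fst p \<noteq> B (snd p)"
  shows "T p < S p"
proof -
  have "fst p \<in> X" "snd p \<in> V" using assms(1) by (simp_all only: mem_Times_iff)
  from B_min[OF this(2,1) assms(2)] show ?thesis by (simp add: T_def S_def)
qed

lemma T_le_S:
  assumes "p \<in> X \<times> V"
  shows "T p \<le> S p"
proof (cases "fst p = B (snd p)")
  case True
  then have "p = (B (snd p), snd p)" by (simp add: prod_eq_iff)
  then show ?thesis unfolding T_def by (metis order_refl)
next
  case False
  with assms show ?thesis by (intro less_imp_le T_less_S)
qed

lemma indicator_T_le_S: "indicator (X \<times> V) p * T p \<le> indicator (X \<times> V) p * S p"
proof (cases "p \<in> X \<times> V")
  case True
  from T_le_S[OF this] show ?thesis by (intro mult_left_mono) simp_all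
qed simp

lemma indicator_S_nonneg: "0 \<le> indicator (X \<times> V) p * S p"
proof (cases "p \<in> X \<times> V")
  case True
  then have "fst p \<in> X" "\<And>k. k < K \<Longrightarrow> snd p k \<in> Y k" by (simp_all add: mem_Times_iff PiE_iff)
  then have "0 \<le> S p" unfolding S_def by (intro sum_nonneg c_nonneg) simp_all
  then show ?thesis by simp
qed simp

lemma Bext_in: "Bext K X Y B v \<in> X"
proof (cases "v \<in> V")
  case False
  have "(SOME x. x \<in> X) \<in> X" using X_nonempty by (rule some_in_eq[THEN iffD2])
  then show ?thesis unfolding Bext_def using False by simp
qed (simp add: Bext_def B_in)

lemma Bext_meas: "Bext K X Y B \<in> measurable (Ymeas K) borel"
proof -
  have "(\<lambda>v. if v \<in> V then B v else (SOME x. x \<in> X)) \<in> measurable (Ymeas K) borel"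
    by (intro borel_on_measurable[OF borel_on_V] borel_measurable_continuous_on_restrict B_cont) simp
  then show ?thesis by (simp add: Bext_def[abs_def])
qed

section \<open>A single plan in \<Gamma>(\<mu>): where it is carried, its costs, and the descent
  step\<close>

context
  fixes \<mu> \<gamma>
  assumes \<mu>: "Prob_on X \<mu>" and \<gamma>: "\<gamma> \<in> \<Gamma> \<mu>"
begin

lemma \<gamma>_prob: "prob_space \<gamma>" and \<gamma>_sets: "sets \<gamma> = sets M"
  and \<gamma>_opt: "k < K \<Longrightarrow> distr \<gamma> BB (\<lambda>p. (fst p, snd p k)) \<in> opt_couplings X (Y k) (c k) \<mu> (\<nu> k)"
  using \<gamma> by (simp_all add: Gamma_set_def case_prod_unfold)

lemma \<gamma>_meas: "measurable \<gamma> N = measurable M N"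
  by (rule measurable_cong_sets[OF \<gamma>_sets refl])

lemma \<gamma>_pair_proj: "k < K \<Longrightarrow> (\<lambda>p. (fst p, snd p k)) \<in> measurable \<gamma> BB"
  unfolding \<gamma>_meas by (rule pair_proj_meas)

lemma \<gamma>_fst: "fst \<in> measurable \<gamma> borel" and \<gamma>_snd: "snd \<in> measurable \<gamma> (Ymeas K)"
  unfolding \<gamma>_meas by (rule measurable_fst measurable_snd)+

lemma \<gamma>_snd_k: "k < K \<Longrightarrow> (\<lambda>p. snd p k) \<in> measurable \<gamma> borel"
  by (rule measurable_compose[OF \<gamma>_snd proj_meas])

text \<open>Read off from the coupling with index 0, which exists because
  \<open>K > 0\<close>.\<close>

lemma distr_fst: "distr \<gamma> borel fst = \<mu>"
proof -
  have "distr (distr \<gamma> BB (\<lambda>p. (fst p, snd p 0))) borel fst = \<mu>"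
    using \<gamma>_opt[OF K_pos] by (simp add: opt_couplings_def couplings_def)
  then show ?thesis
    by (subst (asm) distr_distr[OF _ \<gamma>_pair_proj[OF K_pos]]) (simp_all add: comp_def)
qed

lemma distr_snd_k: 
  assumes "k < K"
  shows "distr \<gamma> borel (\<lambda>p. snd p k) = \<nu> k"
proof -
  have "distr (distr \<gamma> BB (\<lambda>p. (fst p, snd p k))) borel snd = \<nu> k"
    using \<gamma>_opt[OF assms] by (simp add: opt_couplings_def couplings_def)
  then show ?thesis
    by (subst (asm) distr_distr[OF _ \<gamma>_pair_proj[OF assms]]) (simp_all add: comp_def)
qed

text \<open>The plan is a measure on the ambient product. Its marginals \<mu> and \<nu> locate x and
  the finitely many coordinates of Y, while extensionality is built into the space of the product
  sigma-algebra.\<close>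

lemma AE_XV: "AE p in \<gamma>. p \<in> X \<times> V"
proof -
  have "AE p in \<gamma>. fst p \<in> X"
    by (rule AE_distrD[OF \<gamma>_fst]) (subst distr_fst, rule Prob_onD[OF \<mu> X_compact])
  moreover have "AE p in \<gamma>. snd p k \<in> Y k" if "k < K" for k
    by (rule AE_distrD[OF \<gamma>_snd_k[OF that]])
       (subst distr_snd_k[OF that], rule Prob_onD[OF \<nu>_prob[OF that] Y_compact[OF that]])
  then have "AE p in \<gamma>. \<forall>k\<in>{..<K}. snd p k \<in> Y k" by (intro AE_finite_allI) auto
  moreover have "AE p in \<gamma>. snd p \<in> extensional {..<K}"
    using measurable_space[OF \<gamma>_snd] by (intro AE_I2) (auto simp: Ymeas_def space_PiM PiE_def)
  ultimately show ?thesis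
    by eventually_elim (auto simp: mem_Times_iff PiE_iff)
qed

lemma bary_eq: "bary \<gamma> = distr \<gamma> borel (\<lambda>p. Bext K X Y B (snd p))"
  unfolding bary_def by (subst distr_distr[OF Bext_meas \<gamma>_snd]) (simp add: comp_def)

lemma Bext_snd_meas: "(\<lambda>p. Bext K X Y B (snd p)) \<in> measurable \<gamma> borel"
  by (rule measurable_compose[OF \<gamma>_snd Bext_meas])

lemma Prob_on_bary: "Prob_on X (bary \<gamma>)"
proof (rule Prob_onI)
  interpret prob_space \<gamma> by (rule \<gamma>_prob)
  show "prob_space (bary \<gamma>)" unfolding bary_eq by (rule prob_space_distr[OF Bext_snd_meas])
  show "sets (bary \<gamma>) = sets borel" by (simp add: bary_def)
  show "AE x in bary \<gamma>. x \<in> X"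
    unfolding bary_eq using X_compact
    by (subst AE_distr_iff[OF Bext_snd_meas]) (auto intro: borel_compact simp: Bext_in)
qed (rule X_compact)

lemma integrable_XV:
  fixes f :: "_ \<Rightarrow> real"
  assumes "continuous_on (X \<times> V) f"
  shows "integrable \<gamma> (\<lambda>p. indicator (X \<times> V) p * f p)"
proof -
  have "(\<lambda>p. p) \<in> measurable \<gamma> M" by (rule measurable_ident_sets[OF \<gamma>_sets])
  from integrable_continuous_compact[OF \<gamma>_prob borel_on_XV assms this] show ?thesis .
qed

lemma min_cost_le: "min_cost \<gamma> \<le> cost \<gamma>"
  unfolding min_cost_def cost_def
proof (rule integral_mono)
  show "indicator (X \<times> V) p * T p \<le> indicator (X \<times> V) p * S p" for p
    by (intro indicator_T_le_S)
qed (rule integrable_XV[OF T_cont] integrable_XV[OF S_cont])+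

lemma cost_nonneg: "cost \<gamma> \<ge> 0"
  unfolding cost_def by (intro Bochner_Integration.integral_nonneg indicator_S_nonneg)

text \<open>Each summand of \<open>S\<close> sees one pair of coordinates only. Since these pairs
  are optimally coupled, the right-hand side is a sum of optimal transport values and hence the same
  for all plans in \<Gamma>(\<mu>).\<close>

lemma cost_eq_sum:
  "cost \<gamma> = (\<Sum>k<K. cost_of X (Y k) (c k) (distr \<gamma> BB (\<lambda>p. (fst p, snd p k))))"
proof -
  have "cost \<gamma> = (\<integral>p. (\<Sum>k<K. indicator (X \<times> V) p * c k (fst p) (snd p k)) \<partial>\<gamma>)"
    by (simp add: cost_def S_def sum_distrib_left)
  also have "\<dots> = (\<Sum>k<K. \<integral>p. indicator (X \<times> V) p * c k (fst p) (snd p k) \<partial>\<gamma>)"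
    by (intro Bochner_Integration.integral_sum integrable_XV c_cont_XV) simp
  also have "\<dots> = (\<Sum>k<K. cost_of X (Y k) (c k) (distr \<gamma> BB (\<lambda>p. (fst p, snd p k))))"
  proof (intro sum.cong refl)
    fix k assume "k \<in> {..<K}"
    then have k: "k < K" by simp
    have E: "borel_on (X \<times> Y k) BB" by (intro borel_on_pair borel_on_borel X_compact Y_compact k)
    show "(\<integral>p. indicator (X \<times> V) p * c k (fst p) (snd p k) \<partial>\<gamma>) =
      cost_of X (Y k) (c k) (distr \<gamma> BB (\<lambda>p. (fst p, snd p k)))"
      unfolding cost_of_distr[OF X_compact Y_compact[OF k] c_cont[OF k] \<gamma>_pair_proj[OF k]]
    proof (rule integral_cong_AE)
      show "(\<lambda>p. indicator (X \<times> V) p * c k (fst p) (snd p k)) \<in> borel_measurable \<gamma>"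
        by (rule borel_measurable_integrable[OF integrable_XV[OF c_cont_XV[OF k]]])
      show "(\<lambda>p. indicator (X \<times> Y k) (fst p, snd p k) * (case (fst p, snd p k) of (x, y) \<Rightarrow> c k x y))
          \<in> borel_measurable \<gamma>"
        by (rule measurable_compose[OF \<gamma>_pair_proj[OF k] borel_on_real_measurable[OF E c_cont[OF k]]])
      show "AE p in \<gamma>. indicator (X \<times> V) p * c k (fst p) (snd p k) =
          indicator (X \<times> Y k) (fst p, snd p k) * (case (fst p, snd p k) of (x, y) \<Rightarrow> c k x y)"
        using AE_XV
      proof eventually_elim
        case (elim p)
        then have "(fst p, snd p k) \<in> X \<times> Y k" using k by (auto simp: mem_Times_iff PiE_iff)
        with elim show ?case by (simp only: indicator_simps case_prod_conv)
      qed
    qed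
  qed
  finally show ?thesis .
qed

lemma cost_step_le:
  assumes \<gamma>': "\<gamma>' \<in> \<Gamma> (bary \<gamma>)"
  shows "(\<Sum>k<K. cost_of X (Y k) (c k) (distr \<gamma>' BB (\<lambda>p. (fst p, snd p k)))) \<le> min_cost \<gamma>"
proof -
  interpret prob_space \<gamma> by (rule \<gamma>_prob)
  \<comment> \<open>The law of \<open>g k\<close> is the competitor for the \<open>k\<close>-th
    problem at \<open>bary \<gamma>\<close>. \<open>Bext\<close> stands for \<open>B\<close> here
    because the map has to be measurable on the whole space.\<close>
  define g where "g k p = (Bext K X Y B (snd p), snd p k)" for k and p :: "'a \<times> (nat \<Rightarrow> 'b)"
  have g: "g k \<in> measurable \<gamma> BB" if "k < K" for k
    unfolding g_def by (intro measurable_Pair Bext_snd_meas \<gamma>_snd_k that)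
  have "cost_of X (Y k) (c k) (distr \<gamma>' BB (\<lambda>p. (fst p, snd p k))) \<le>
      cost_of X (Y k) (c k) (distr \<gamma> BB (g k))" if k: "k < K" for k
  proof -
    have "distr \<gamma> BB (g k) \<in> couplings (bary \<gamma>) (\<nu> k)"
      unfolding couplings_def
    proof (intro CollectI conjI)
      show "prob_space (distr \<gamma> BB (g k))" by (rule prob_space_distr[OF g[OF k]])
      show "distr (distr \<gamma> BB (g k)) borel fst = bary \<gamma>"
        by (subst distr_distr[OF _ g[OF k]]) (simp_all add: comp_def g_def bary_eq)
      show "distr (distr \<gamma> BB (g k)) borel snd = \<nu> k"
        by (subst distr_distr[OF _ g[OF k]]) (simp_all add: comp_def g_def distr_snd_k[OF k])
    qed simp
    moreover have "distr \<gamma>' BB (\<lambda>p. (fst p, snd p k)) \<in> opt_couplings X (Y k) (c k) (bary \<gamma>) (\<nu> k)"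
      using \<gamma>' k by (simp add: Gamma_set_def case_prod_unfold)
    ultimately show ?thesis by (simp add: opt_couplings_def)
  qed
  then have "(\<Sum>k<K. cost_of X (Y k) (c k) (distr \<gamma>' BB (\<lambda>p. (fst p, snd p k)))) \<le>
      (\<Sum>k<K. cost_of X (Y k) (c k) (distr \<gamma> BB (g k)))"
    by (intro sum_mono) simp
  also have "\<dots> = (\<Sum>k<K. \<integral>p. indicator (X \<times> Y k) (g k p) * (case g k p of (x, y) \<Rightarrow> c k x y) \<partial>\<gamma>)"
    by (intro sum.cong refl cost_of_distr X_compact Y_compact c_cont g) simp_all
  also have "\<dots> = (\<integral>p. (\<Sum>k<K. indicator (X \<times> Y k) (g k p) * (case g k p of (x, y) \<Rightarrow> c k x y)) \<partial>\<gamma>)"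
  proof (rule Bochner_Integration.integral_sum[symmetric])
    fix k assume "k \<in> {..<K}"
    then have k: "k < K" by simp
    have E: "borel_on (X \<times> Y k) BB" by (intro borel_on_pair borel_on_borel X_compact Y_compact k)
    show "integrable \<gamma> (\<lambda>p. indicator (X \<times> Y k) (g k p) * (case g k p of (x, y) \<Rightarrow> c k x y))"
      by (rule integrable_continuous_compact[OF \<gamma>_prob E c_cont[OF k] g[OF k]])
  qed
  also have "\<dots> = min_cost \<gamma>"
    unfolding min_cost_def
  proof (rule integral_cong_AE)
    show "(\<lambda>p. indicator (X \<times> V) p * T p) \<in> borel_measurable \<gamma>"
      by (rule borel_measurable_integrable[OF integrable_XV[OF T_cont]])
    show "(\<lambda>p. \<Sum>k<K. indicator (X \<times> Y k) (g k p) * (case g k p of (x, y) \<Rightarrow> c k x y)) \<in> borel_measurable \<gamma>"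
    proof (rule borel_measurable_sum)
      fix k assume "k \<in> {..<K}"
      then have k: "k < K" by simp
      have E: "borel_on (X \<times> Y k) BB" by (intro borel_on_pair borel_on_borel X_compact Y_compact k)
      show "(\<lambda>p. indicator (X \<times> Y k) (g k p) * (case g k p of (x, y) \<Rightarrow> c k x y)) \<in> borel_measurable \<gamma>"
        by (rule measurable_compose[OF g[OF k] borel_on_real_measurable[OF E c_cont[OF k]]])
    qed
    show "AE p in \<gamma>. (\<Sum>k<K. indicator (X \<times> Y k) (g k p) * (case g k p of (x, y) \<Rightarrow> c k x y)) =
        indicator (X \<times> V) p * T p"
      using AE_XV
    proof eventually_elim
      case (elim p)
      then have V: "snd p \<in> V" by (simp only: mem_Times_iff)
      have "indicator (X \<times> Y k) (g k p) * (case g k p of (x, y) \<Rightarrow> c k x y) = c k (B (snd p)) (snd p k)"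
        if "k < K" for k
      proof -
        have "g k p = (B (snd p), snd p k)" using V by (simp add: g_def Bext_def)
        moreover have "(B (snd p), snd p k) \<in> X \<times> Y k" using V that B_in[OF V] by (simp add: PiE_iff)
        ultimately show ?thesis by simp
      qed
      then have "(\<Sum>k<K. indicator (X \<times> Y k) (g k p) * (case g k p of (x, y) \<Rightarrow> c k x y)) = T p"
        unfolding T_def S_def by (intro sum.cong) simp_all
      with elim show ?case by (simp only: indicator_simps mult_1)
    qed
  qed
  finally show ?thesis .
qed

end

text \<open>The difference of the two integrands is nonnegative with integral 0, so it vanishes
  almost surely. Strictness of the minimum then gives x = B(Y) almost surely, and almost surely
  equal maps have the same law.\<close>

lemma fixed_point_of_cost_eq:
  assumes \<mu>: "Prob_on X \<mu>" and \<gamma>: "\<gamma> \<in> \<Gamma> \<mu>" and eq: "cost \<gamma> = min_cost \<gamma>"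
  shows "\<mu> = bary \<gamma>"
proof -
  note int = integrable_XV[OF \<mu> \<gamma>]
  let ?d = "\<lambda>p. indicator (X \<times> V) p * S p - indicator (X \<times> V) p * T p"
  have "integrable \<gamma> ?d" by (intro Bochner_Integration.integrable_diff int S_cont T_cont)
  moreover have "AE p in \<gamma>. 0 \<le> ?d p" by (intro AE_I2) (simp only: diff_ge_0_iff_ge indicator_T_le_S)
  moreover have "(\<integral>p. ?d p \<partial>\<gamma>) = 0"
    using eq by (subst Bochner_Integration.integral_diff) (simp_all add: int S_cont T_cont cost_def min_cost_def)
  ultimately have "AE p in \<gamma>. ?d p = 0" by (subst (asm) integral_nonneg_eq_0_iff_AE)
  then have "AE p in \<gamma>. fst p = Bext K X Y B (snd p)"
    using AE_XV[OF \<mu> \<gamma>]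
  proof eventually_elim
    case (elim p)
    then have "T p = S p" by (simp only: indicator_simps mult_1 right_minus_eq)
    with T_less_S[OF elim(2)] have "fst p = B (snd p)" by linarith
    moreover have "snd p \<in> V" using elim(2) by (simp only: mem_Times_iff)
    ultimately show ?case by (simp only: Bext_def if_True)
  qed
  then have "distr \<gamma> borel fst = distr \<gamma> borel (\<lambda>p. Bext K X Y B (snd p))"
    by (intro distr_cong_AE \<gamma>_fst[OF \<mu> \<gamma>] Bext_snd_meas[OF \<mu> \<gamma>]) simp_all
  then show ?thesis by (simp add: distr_fst[OF \<mu> \<gamma>] bary_eq[OF \<mu> \<gamma>])
qed

lemma weak_limit_is_fixed_point:
  assumes \<mu>s: "\<And>t. Prob_on X (\<mu>s t)" and \<gamma>: "\<And>t. \<gamma> t \<in> \<Gamma> (\<mu>s t)" and step: "\<And>t. \<mu>s (Suc t) = bary (\<gamma> t)"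
    and r: "strict_mono r" and \<mu>: "Prob_on X \<mu>" and conv: "weak_conv_on X (\<mu>s \<circ> r) \<mu>"
  shows "\<mu> \<in> G_set K X Y c \<nu> B \<mu>"
proof -
  have mc_le: "min_cost (\<gamma> t) \<le> cost (\<gamma> t)" for t by (rule min_cost_le[OF \<mu>s \<gamma>])
  have le_mc: "cost (\<gamma> (Suc t)) \<le> min_cost (\<gamma> t)" for t
    using cost_step_le[OF \<mu>s \<gamma>[of t], of "\<gamma> (Suc t)"] \<gamma>[of "Suc t"]
    by (simp add: cost_eq_sum[OF \<mu>s \<gamma>] step)
  have "decseq (\<lambda>t. cost (\<gamma> t))"
    using mc_le le_mc order_trans by (intro decseq_SucI) blast
  then obtain L where L: "(\<lambda>t. cost (\<gamma> t)) \<longlonglongrightarrow> L"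
    using decseq_convergent[of "\<lambda>t. cost (\<gamma> t)" 0] cost_nonneg[OF \<mu>s \<gamma>] by blast
  \<comment> \<open>\<open>min_cost\<close> at t lies between \<open>cost\<close> at t+1 and
    \<open>cost\<close> at t.\<close>
  have L': "(\<lambda>t. min_cost (\<gamma> t)) \<longlonglongrightarrow> L"
    by (rule tendsto_sandwich[OF _ _ LIMSEQ_Suc[OF L] L]) (use mc_le le_mc in auto)

  \<comment> \<open>The plans along \<open>r\<close> converge only after passing to a further
    subsequence \<open>q\<close>, which leaves the weak limit \<mu> of their first marginals
    unchanged.\<close>
  obtain \<Omega> :: "real measure" and q Z W where \<Omega>: "prob_space \<Omega>" and q: "strict_mono q"
    and Z: "\<And>n. Z n \<in> measurable \<Omega> M" "\<And>n. distr \<Omega> M (Z n) = \<gamma> (r (q n))" "\<And>n \<omega>. Z n \<omega> \<in> X \<times> V"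
    and W: "W \<in> measurable \<Omega> M" "\<And>\<omega>. W \<omega> \<in> X \<times> V" "AE \<omega> in \<Omega>. (\<lambda>n. Z n \<omega>) \<longlonglongrightarrow> W \<omega>"
    using skorohod_compact[OF borel_on_XV, of "\<lambda>n. \<gamma> (r n)",
        OF \<gamma>_prob[OF \<mu>s \<gamma>] \<gamma>_sets[OF \<mu>s \<gamma>] AE_XV[OF \<mu>s \<gamma>]]
    by blast
  interpret \<Omega>: prob_space \<Omega> by fact
  define \<gamma>lim where "\<gamma>lim = distr \<Omega> M W"
  have rq: "strict_mono (r \<circ> q)" using r q by (rule strict_mono_o)

  have int_lim: "(\<lambda>n. \<integral>p. indicator (X \<times> V) p * f p \<partial>\<gamma> (r (q n))) \<longlonglongrightarrow> (\<integral>p. indicator (X \<times> V) p * f p \<partial>\<gamma>lim)"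
    if f: "continuous_on (X \<times> V) f" for f :: "_ \<Rightarrow> real"
  proof -
    note g = borel_on_real_measurable[OF borel_on_XV f]
    have "(\<lambda>n. \<integral>\<omega>. indicator (X \<times> V) (Z n \<omega>) * f (Z n \<omega>) \<partial>\<Omega>) \<longlonglongrightarrow>
        (\<integral>\<omega>. indicator (X \<times> V) (W \<omega>) * f (W \<omega>) \<partial>\<Omega>)"
      by (rule integral_tendsto_continuous[OF \<Omega> borel_on_XV f Z(1) W(1) _ _ W(3)])
         (intro AE_I2 allI Z(3) W(2))+
    then show ?thesis
      by (simp only: Z(2)[symmetric] \<gamma>lim_def integral_distr[OF Z(1) g] integral_distr[OF W(1) g])
  qed
  \<comment> \<open>Here continuity of both integrands is used; for \<open>T\<close> it rests on the
    continuity of \<open>B\<close>.\<close>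
  have "cost \<gamma>lim = L"
    using LIMSEQ_unique[OF int_lim[OF S_cont, folded cost_def] LIMSEQ_subseq_LIMSEQ[OF L rq, unfolded comp_def]] .
  moreover have "min_cost \<gamma>lim = L"
    using LIMSEQ_unique[OF int_lim[OF T_cont, folded min_cost_def] LIMSEQ_subseq_LIMSEQ[OF L' rq, unfolded comp_def]] .
  ultimately have costs: "cost \<gamma>lim = min_cost \<gamma>lim" by simp

  have fstZ: "(\<lambda>\<omega>. fst (Z n \<omega>)) \<in> borel_measurable \<Omega>" for n by (rule measurable_compose[OF Z(1) measurable_fst])
  have fstW: "(\<lambda>\<omega>. fst (W \<omega>)) \<in> borel_measurable \<Omega>" by (rule measurable_compose[OF W(1) measurable_fst])
  have fst_lim: "AE \<omega> in \<Omega>. (\<lambda>n. fst (Z n \<omega>)) \<longlonglongrightarrow> fst (W \<omega>)"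
    using W(3) by eventually_elim (rule tendsto_fst)
  have ZX: "fst (Z n \<omega>) \<in> X" and ZV: "snd (Z n \<omega>) \<in> V" for n \<omega>
    using Z(3)[of n \<omega>] by (simp_all only: mem_Times_iff)
  have WX: "fst (W \<omega>) \<in> X" and WV: "snd (W \<omega>) \<in> V" for \<omega>
    using W(2)[of \<omega>] by (simp_all only: mem_Times_iff)
  have Z_law: "distr \<Omega> borel (\<lambda>\<omega>. fst (Z n \<omega>)) = \<mu>s (r (q n))" for n
  proof -
    have "distr \<Omega> borel (\<lambda>\<omega>. fst (Z n \<omega>)) = distr (\<gamma> (r (q n))) borel fst"
      unfolding Z(2)[symmetric] by (subst distr_distr[OF measurable_fst Z(1)]) (simp add: comp_def)
    then show ?thesis by (simp only: distr_fst[OF \<mu>s \<gamma>])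
  qed
  have W_law: "distr \<Omega> borel (\<lambda>\<omega>. fst (W \<omega>)) = \<mu>"
  proof (rule distr_limit_eqI[OF X_compact \<Omega> \<mu> fstZ ZX fstW WX fst_lim])
    show "weak_conv_on X (\<lambda>n. distr \<Omega> borel (\<lambda>\<omega>. fst (Z n \<omega>))) \<mu>"
      unfolding weak_conv_on_def
    proof (intro allI impI)
      fix f :: "'a \<Rightarrow> real" assume "continuous_on X f"
      then have "(\<lambda>n. \<integral>x. indicator X x * f x \<partial>(\<mu>s \<circ> r) n) \<longlonglongrightarrow> (\<integral>x. indicator X x * f x \<partial>\<mu>)"
        using conv by (simp only: weak_conv_on_def)
      from LIMSEQ_subseq_LIMSEQ[OF this q]
      show "(\<lambda>n. \<integral>x. indicator X x * f x \<partial>distr \<Omega> borel (\<lambda>\<omega>. fst (Z n \<omega>))) \<longlonglongrightarrow> (\<integral>x. indicator X x * f x \<partial>\<mu>)"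
        by (simp only: Z_law comp_def)
    qed
  qed

  have "distr \<gamma>lim BB (\<lambda>p. (fst p, snd p k)) \<in> opt_couplings X (Y k) (c k) \<mu> (\<nu> k)" if k: "k < K" for k
  proof -
    have sndZ: "(\<lambda>\<omega>. snd (Z n \<omega>) k) \<in> borel_measurable \<Omega>" for n
      by (rule measurable_compose[OF Z(1) measurable_compose[OF measurable_snd proj_meas[OF k]]])
    have sndW: "(\<lambda>\<omega>. snd (W \<omega>) k) \<in> borel_measurable \<Omega>"
      by (rule measurable_compose[OF W(1) measurable_compose[OF measurable_snd proj_meas[OF k]]])
    have snd_lim: "AE \<omega> in \<Omega>. (\<lambda>n. snd (Z n \<omega>) k) \<longlonglongrightarrow> snd (W \<omega>) k"
      using W(3)
    proof eventually_elim
      case (elim \<omega>)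
      have "continuous_on UNIV (\<lambda>f::nat \<Rightarrow> 'b. f k)" by (rule continuous_on_product_coordinates)
      from continuous_on_tendsto_compose[OF this tendsto_snd[OF elim]] show ?case by simp
    qed
    have ZY: "snd (Z n \<omega>) k \<in> Y k" and WY: "snd (W \<omega>) k \<in> Y k" for n \<omega>
      using PiE_mem[OF ZV] PiE_mem[OF WV] k by simp_all
    have sndZ_law: "distr \<Omega> borel (\<lambda>\<omega>. snd (Z n \<omega>) k) = \<nu> k" for n
    proof -
      have "distr \<Omega> borel (\<lambda>\<omega>. snd (Z n \<omega>) k) = distr (\<gamma> (r (q n))) borel (\<lambda>p. snd p k)"
        unfolding Z(2)[symmetric]
        by (subst distr_distr[OF measurable_compose[OF measurable_snd proj_meas[OF k]] Z(1)]) (simp add: comp_def)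
      then show ?thesis by (simp only: distr_snd_k[OF \<mu>s \<gamma> k])
    qed
    \<comment> \<open>The second marginals form the constant sequence \<open>\<nu> k\<close>, whose
      weak limit is immediate.\<close>
    have sndW_law: "distr \<Omega> borel (\<lambda>\<omega>. snd (W \<omega>) k) = \<nu> k"
      by (rule distr_limit_eqI[OF Y_compact[OF k] \<Omega> \<nu>_prob[OF k] sndZ ZY sndW WY snd_lim])
         (simp add: sndZ_law weak_conv_on_def)
    have "distr \<Omega> BB (\<lambda>\<omega>. (fst (Z n \<omega>), snd (Z n \<omega>) k)) \<in> opt_couplings X (Y k) (c k) (\<mu>s (r (q n))) (\<nu> k)" for n
    proof -
      have "distr \<Omega> BB (\<lambda>\<omega>. (fst (Z n \<omega>), snd (Z n \<omega>) k)) = distr (\<gamma> (r (q n))) BB (\<lambda>p. (fst p, snd p k))"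
        unfolding Z(2)[symmetric] by (subst distr_distr[OF pair_proj_meas[OF k] Z(1)]) (simp add: comp_def)
      then show ?thesis using \<gamma>_opt[OF \<mu>s \<gamma> k] by (simp only:)
    qed
    from opt_couplings_limit[OF X_compact Y_compact[OF k] c_cont[OF k] \<Omega> fstZ AE_I2[OF ZX] fstW AE_I2[OF WX]
        fst_lim sndZ AE_I2[OF ZY] sndW AE_I2[OF WY] snd_lim this W_law sndW_law]
    have "distr \<Omega> BB (\<lambda>\<omega>. (fst (W \<omega>), snd (W \<omega>) k)) \<in> opt_couplings X (Y k) (c k) \<mu> (\<nu> k)" .
    then show ?thesis
      unfolding \<gamma>lim_def by (subst distr_distr[OF pair_proj_meas[OF k] W(1)]) (simp add: comp_def)
  qed
  moreover have "prob_space \<gamma>lim" unfolding \<gamma>lim_def by (rule \<Omega>.prob_space_distr[OF W(1)])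
  ultimately have \<gamma>lim: "\<gamma>lim \<in> \<Gamma> \<mu>"
    by (simp add: Gamma_set_def case_prod_unfold \<gamma>lim_def)
  have "\<mu> = bary \<gamma>lim" by (rule fixed_point_of_cost_eq[OF \<mu> \<gamma>lim costs])
  with \<gamma>lim show ?thesis unfolding G_set_def bary_def by blast
qed

end

theorem theorem1:
  fixes K :: nat
    and X :: "'a::metric_space set"
    and Y :: "nat \<Rightarrow> 'b::metric_space set"
    and c :: "nat \<Rightarrow> 'a \<Rightarrow> 'b \<Rightarrow> real"
    and B :: "(nat \<Rightarrow> 'b) \<Rightarrow> 'a"
    and \<nu> :: "nat \<Rightarrow> 'b measure"
    and \<mu>s :: "nat \<Rightarrow> 'a measure"
  assumes X_compact: "compact X"
    and Y_compact: "\<forall>k<K. compact (Y k)"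
    and c_cont: "\<forall>k<K. continuous_on (X \<times> Y k) (\<lambda>(x, y). c k x y)"
    and c_nonneg: "\<forall>k<K. \<forall>x\<in>X. \<forall>y\<in>Y k. c k x y \<ge> 0"
    and B_min: "\<forall>v\<in>PiE {..<K} Y. B v \<in> X \<and>
                  (\<forall>x\<in>X. x \<noteq> B v \<longrightarrow> (\<Sum>k<K. c k (B v) (v k)) < (\<Sum>k<K. c k x (v k)))"
    and nontriv: "\<exists>x\<in>X. \<exists>v\<in>PiE {..<K} Y. x \<noteq> B v"
    and \<nu>_prob: "\<forall>k<K. Prob_on (Y k) (\<nu> k)"
    and \<mu>0: "Prob_on X (\<mu>s 0)"
    and step: "\<forall>t. \<mu>s (Suc t) \<in> G_set K X Y c \<nu> B (\<mu>s t)"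
  shows "(\<exists>r \<mu>. strict_mono r \<and> Prob_on X \<mu> \<and> weak_conv_on X (\<mu>s \<circ> r) \<mu>) \<and>
         (\<forall>r \<mu>. strict_mono r \<and> Prob_on X \<mu> \<and> weak_conv_on X (\<mu>s \<circ> r) \<mu>
              \<longrightarrow> \<mu> \<in> G_set K X Y c \<nu> B \<mu>)"
proof -
  \<comment> \<open>For \<open>K = 0\<close> both sums are empty, so the strict inequality at the
    point provided by \<open>nontriv\<close> would read 0 < 0.\<close>
  have "K > 0"
  proof (rule ccontr)
    assume "\<not> K > 0"
    with nontriv B_min show False by fastforce
  qed
  moreover have "X \<noteq> {}" using nontriv by blast
  ultimately interpret barycentre_problem K X Y c B \<nu>
    using assms by unfold_locales auto
  have "\<forall>t. \<exists>\<gamma>. \<gamma> \<in> \<Gamma> (\<mu>s t) \<and> \<mu>s (Suc t) = bary \<gamma>"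
    using step unfolding G_set_def bary_def by blast
  from choice[OF this] obtain \<gamma> where \<gamma>: "\<And>t. \<gamma> t \<in> \<Gamma> (\<mu>s t)" "\<And>t. \<mu>s (Suc t) = bary (\<gamma> t)"
    by blast
  \<comment> \<open>Only the initial measure is assumed to be carried by \<open>X\<close>; the later
    ones are because \<open>Bext\<close> takes all its values in \<open>X\<close>.\<close>
  have prob: "Prob_on X (\<mu>s t)" for t
  proof (induction t)
    case (Suc t)
    then show ?case unfolding \<gamma>(2) by (rule Prob_on_bary[OF _ \<gamma>(1)])
  qed (rule \<mu>0)
  show ?thesis
  proof (intro conjI allI impI)
    show "\<exists>r \<mu>. strict_mono r \<and> Prob_on X \<mu> \<and> weak_conv_on X (\<mu>s \<circ> r) \<mu>"
      by (rule weak_subsequence_exists[OF X_compact prob])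
    fix r \<mu> assume "strict_mono r \<and> Prob_on X \<mu> \<and> weak_conv_on X (\<mu>s \<circ> r) \<mu>"
    then show "\<mu> \<in> G_set K X Y c \<nu> B \<mu>"
      by (elim conjE) (rule weak_limit_is_fixed_point[where \<mu>s = \<mu>s and \<gamma> = \<gamma>, OF prob \<gamma>])
  qed
qed

end
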